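(* Let $M$ be a connected smooth manifold of dimension $n\ge 2$ and let $S$ be a spray on $M$ with non-vanishing Ricci curvature (i.e. $\operatorname{Tr}\Phi$ vanishes nowhere on $T_0M$), where $\Phi$ is the Jacobi endomorphism of $S$. Then $S$ is metrizable by a Finsler function of non-zero constant flag curvature if and only if $\Phi$ satisfies the following three conditions on $T_0M$: \begin{itemize} \item[(A)] $\operatorname{rank}\, d d_J(\operatorname{Tr}\Phi)=2n$; \item[(D$_1$)] $2(n-1)\Phi-2(\operatorname{Tr}\Phi)\,J+d_J(\operatorname{Tr}\Phi)\otimes\mathbb{C}=0$; \item[(D$_2$)] $d_h(\operatorname{Tr}\Phi)=0$. \end{itemize}
   Context: $M$ is a $C^\infty$ real connected $n$-dimensional manifold, $n\ge2$; $T_0M=TM\setminus\{0\}$ is the tangent bundle with the zero section removed, with induced coordinates $(x^i,y^i)$. Summation over repeated indices is understood. The tangent structure and the Liouville vector field are $J=\frac{\partial}{\partial y^i}\otimes dx^i$ and $\mathbb{C}=y^i\frac{\partial}{\partial y^i}$. A spray is a smooth vector field $S$ on $T_0M$ with $JS=\mathbb{C}$ and $[\mathbb{C},S]=S$; locally $S=y^i\frac{\partial}{\partial x^i}-2G^i(x,y)\frac{\partial}{\partial y^i}$ with $G^i$ smooth and (positively) $2$-homogeneous in $y$. The horizontal and vertical projectors of $S$ are $h=\frac12(\operatorname{Id}-\mathcal{L}_SJ)$, $v=\frac12(\operatorname{Id}+\mathcal{L}_SJ)$; locally $h(\partial/\partial x^i)=\frac{\delta}{\delta x^i}=\frac{\partial}{\partial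 x^i}-\frac{\partial G^j}{\partial y^i}\frac{\partial}{\partial y^j}$ and $h(\partial/\partial y^i)=0$. The Jacobi endomorphism of $S$ is the vector-valued semi-basic $1$-form $\Phi=v\circ\mathcal{L}_Sh=R^i_j\frac{\partial}{\partial y^i}\otimes dx^j$, with $$R^i_j=2\frac{\partial G^i}{\partial x^j}-S\!\left(\frac{\partial G^i}{\partial y^j}\right)-\frac{\partial G^i}{\partial y^r}\frac{\partial G^r}{\partial y^j}.$$ The Ricci curvature is $\operatorname{Ric}=\operatorname{Tr}(\Phi)=R^i_i$, and the Ricci scalar is $R$ with $\operatorname{Ric}=(n-1)R$. For a vector-valued $1$-form $L$, $d_L=i_L\circ d-d\circ i_L$ (Frölicher–Nijenhuis derivation). On functions, $d_Lf=df\circ L$; thus $d_Jf=\frac{\partial f}{\partial y^i}dx^i$ and $d_hf=\frac{\delta f}{\delta x^i}dx^i$. The rank in (A) is the rank of the $2$-form $dd_J(\operatorname{Tr}\Phi)$ at each point of the $2n$-dimensional manifold $T_0M$. A Finsler function is a continuous function $F:TM\to\mathbb{R}$ such that: (i) $F$ is smooth and strictly positive on $T_0M$; (ii) $F(x,\lambda y)=\lambda F(x,y)$ for all $\lambda\ge0$, $(x,y)\in TM$; (iii) the matrix $g_{ij}=\frac12\frac{\partial^2F^2}{\partial y^i\partial y^j}$ has rank $n$ on $T_0M$. Its geodesic spray is the unique vector field $S$ on $T_0M$ with $i_Sdd_JF^2=-dF^2$ (equivalently $\mathcal{L}_Sd_JF^2=dF^2$). A spray $S$ is (Finsler) metrizable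 by $F$ if it satisfies this equation, i.e. is the geodesic spray of $F$. A Finsler function $F$ with geodesic spray $S$ has constant flag curvature $\kappa$ if $\kappa$ is a constant and the Jacobi endomorphism of $S$ is $\Phi=\kappa\left(F^2J-F\,d_JF\otimes\mathbb{C}\right)$. *)

theory Defs
  imports "HOL-Analysis.Analysis"
begin

section \<open>Smooth manifolds and their tangent bundles\<close>

text \<open>Both notions are meant for open \<open>U\<close>.\<close>

primrec Ck_on :: "nat \<Rightarrow> 'e::real_normed_vector set \<Rightarrow> ('e \<Rightarrow> 'f::real_normed_vector) \<Rightarrow> bool" where
  "Ck_on 0 U f \<longleftrightarrow> continuous_on U f"
| "Ck_on (Suc k) U f \<longleftrightarrow> (\<forall>x\<in>U. f differentiable (at x)) \<and>
     (\<forall>v. Ck_on k U (\<lambda>x. frechet_derivative f (at x) v))"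

definition smooth_on :: "'e::real_normed_vector set \<Rightarrow> ('e \<Rightarrow> 'f::real_normed_vector) \<Rightarrow> bool" where
  "smooth_on U f \<longleftrightarrow> (\<forall>k. Ck_on k U f)"

text \<open>An indexed family of charts on a space of points \<open>'a\<close>, modelled on \<open>'e\<close>. Only the charts with
  index in \<open>Index\<close> count, and \<open>Crd A i\<close> is meaningful on \<open>Dom A i\<close> only.\<close>

record ('i, 'a, 'e) atlas =
  Index :: "'i set"
  Dom :: "'i \<Rightarrow> 'a set"
  Crd :: "'i \<Rightarrow> 'a \<Rightarrow> 'e"

definition chart_image :: "('i, 'a, 'e) atlas \<Rightarrow> 'i \<Rightarrow> 'e set" where
  "chart_image A i = Crd A i ` Dom A i"

definition chart_inv :: "('i, 'a, 'e) atlas \<Rightarrow> 'i \<Rightarrow> 'e \<Rightarrow> 'a" where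
  "chart_inv A i = inv_into (Dom A i) (Crd A i)"

definition points :: "('i, 'a, 'e) atlas \<Rightarrow> 'a set" where
  "points A = (\<Union>i\<in>Index A. Dom A i)"

definition smooth_manifold :: "'a topology \<Rightarrow> ('i, 'a, 'e::euclidean_space) atlas \<Rightarrow> bool" where
  "smooth_manifold X A \<longleftrightarrow>
     Hausdorff_space X \<and> second_countable X \<and> topspace X = points A \<and>
     (\<forall>i\<in>Index A. openin X (Dom A i) \<and> open (chart_image A i) \<and>
        homeomorphic_map (subtopology X (Dom A i)) (top_of_set (chart_image A i)) (Crd A i)) \<and>
     (\<forall>i\<in>Index A. \<forall>j\<in>Index A.
        smooth_on (Crd A i ` (Dom A i \<inter> Dom A j)) (Crd A j \<circ> chart_inv A i))"

text \<open>A tangent vector at \<open>p\<close> is the family of its components in all charts around \<open>p\<close>, related by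
  the derivatives of the transition maps; it is padded with \<open>0\<close> at the other indices.\<close>

definition tangent_space :: "('i, 'a, 'e::euclidean_space) atlas \<Rightarrow> 'a \<Rightarrow> ('i \<Rightarrow> 'e) set" where
  "tangent_space A p = {v.
     (\<forall>i. \<not> (i \<in> Index A \<and> p \<in> Dom A i) \<longrightarrow> v i = 0) \<and>
     (\<forall>i\<in>Index A. \<forall>j\<in>Index A. p \<in> Dom A i \<longrightarrow> p \<in> Dom A j \<longrightarrow>
        v j = frechet_derivative (Crd A j \<circ> chart_inv A i) (at (Crd A i p)) (v i))}"

text \<open>\<open>TM\<close> and \<open>T\<^sub>0M\<close>, as sets of pairs (point, tangent vector) with the induced coordinates
  \<open>(x, y)\<close>.\<close>

definition tangent_bundle ::
  "('i, 'a, 'e::euclidean_space) atlas \<Rightarrow> ('i, 'a \<times> ('i \<Rightarrow> 'e), 'e \<times> 'e) atlas" where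
  "tangent_bundle A = \<lparr>Index = Index A,
     Dom = (\<lambda>i. {(p, v). p \<in> Dom A i \<and> v \<in> tangent_space A p}),
     Crd = (\<lambda>i (p, v). (Crd A i p, v i))\<rparr>"

definition slit_tangent_bundle ::
  "('i, 'a, 'e::euclidean_space) atlas \<Rightarrow> ('i, 'a \<times> ('i \<Rightarrow> 'e), 'e \<times> 'e) atlas" where
  "slit_tangent_bundle A = \<lparr>Index = Index A,
     Dom = (\<lambda>i. {(p, v). p \<in> Dom A i \<and> v \<in> tangent_space A p \<and> v \<noteq> (\<lambda>_. 0)}),
     Crd = (\<lambda>i (p, v). (Crd A i p, v i))\<rparr>"

definition fun_rep :: "('i, 'a, 'e) atlas \<Rightarrow> ('a \<Rightarrow> real) \<Rightarrow> 'i \<Rightarrow> 'e \<Rightarrow> real" where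
  "fun_rep A f i = (\<lambda>z. f (chart_inv A i z))"

definition field_rep :: "('i, 'a, 'e) atlas \<Rightarrow> ('a \<Rightarrow> 'i \<Rightarrow> 'e) \<Rightarrow> 'i \<Rightarrow> 'e \<Rightarrow> 'e" where
  "field_rep A Y i = (\<lambda>z. Y (chart_inv A i z) i)"

text \<open>Since the chart domains form an open cover, continuity and smoothness are tested in charts.\<close>

definition continuous_fun :: "('i, 'a, 'e::euclidean_space) atlas \<Rightarrow> ('a \<Rightarrow> real) \<Rightarrow> bool" where
  "continuous_fun A f \<longleftrightarrow> (\<forall>i\<in>Index A. continuous_on (chart_image A i) (fun_rep A f i))"

definition smooth_fun :: "('i, 'a, 'e::euclidean_space) atlas \<Rightarrow> ('a \<Rightarrow> real) \<Rightarrow> bool" where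
  "smooth_fun A f \<longleftrightarrow> (\<forall>i\<in>Index A. smooth_on (chart_image A i) (fun_rep A f i))"

definition smooth_vector_field ::
  "('i, 'a, 'e::euclidean_space) atlas \<Rightarrow> ('a \<Rightarrow> 'i \<Rightarrow> 'e) \<Rightarrow> bool" where
  "smooth_vector_field A Y \<longleftrightarrow>
     (\<forall>p\<in>points A. Y p \<in> tangent_space A p) \<and>
     (\<forall>i\<in>Index A. smooth_on (chart_image A i) (field_rep A Y i))"


section \<open>Calculus in a chart\<close>

text \<open>Tensor fields on an open subset of the model space \<open>'w\<close>: a vector field is \<open>'w \<Rightarrow> 'w\<close>, a
  vector-valued 1-form \<open>'w \<Rightarrow> 'w \<Rightarrow> 'w\<close>, a 1-form \<open>'w \<Rightarrow> 'w \<Rightarrow> real\<close> and a 2-form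
  \<open>'w \<Rightarrow> 'w \<Rightarrow> 'w \<Rightarrow> real\<close>; the first argument is always the base point.\<close>

definition bracket :: "('w::euclidean_space \<Rightarrow> 'w) \<Rightarrow> ('w \<Rightarrow> 'w) \<Rightarrow> 'w \<Rightarrow> 'w" where
  "bracket Y Z = (\<lambda>z. frechet_derivative Z (at z) (Y z) - frechet_derivative Y (at z) (Z z))"

text \<open>\<open>(\<L>\<^sub>Y L) W = [Y, L W] - L [Y, W]\<close>. This is tensorial in \<open>W\<close>, so the value on a
  vector \<open>w\<close> is computed with the constant extension of \<open>w\<close>.\<close>

definition lie_deriv :: "('w::euclidean_space \<Rightarrow> 'w) \<Rightarrow> ('w \<Rightarrow> 'w \<Rightarrow> 'w) \<Rightarrow> 'w \<Rightarrow> 'w \<Rightarrow> 'w" where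
  "lie_deriv Y L = (\<lambda>z w. bracket Y (\<lambda>x. L x w) z - L z (bracket Y (\<lambda>_. w) z))"

definition d0 :: "('w::euclidean_space \<Rightarrow> real) \<Rightarrow> 'w \<Rightarrow> 'w \<Rightarrow> real" where
  "d0 f = (\<lambda>z w. frechet_derivative f (at z) w)"

definition d1 :: "('w::euclidean_space \<Rightarrow> 'w \<Rightarrow> real) \<Rightarrow> 'w \<Rightarrow> 'w \<Rightarrow> 'w \<Rightarrow> real" where
  "d1 \<alpha> = (\<lambda>z u w. frechet_derivative (\<lambda>x. \<alpha> x w) (at z) u
                 - frechet_derivative (\<lambda>x. \<alpha> x u) (at z) w)"

text \<open>The derivation \<open>d\<^sub>L\<close> on functions.\<close>

definition dL :: "('w::euclidean_space \<Rightarrow> 'w \<Rightarrow> 'w) \<Rightarrow> ('w \<Rightarrow> real) \<Rightarrow> 'w \<Rightarrow> 'w \<Rightarrow> real" where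
  "dL L f = (\<lambda>z w. d0 f z (L z w))"

text \<open>The rank of a 2-form at \<open>z\<close> is that of \<open>u \<mapsto> \<omega>\<^sub>z(u, \<cdot>)\<close>, the covector being identified with
  the tuple of its values on the standard basis.\<close>

definition form_rank :: "('w::euclidean_space \<Rightarrow> 'w \<Rightarrow> 'w \<Rightarrow> real) \<Rightarrow> 'w \<Rightarrow> nat" where
  "form_rank \<omega> z = dim (range (\<lambda>u. \<Sum>b\<in>Basis. \<omega> z u b *\<^sub>R b))"


section \<open>Sprays\<close>

text \<open>In induced coordinates a tangent vector of \<open>T\<^sub>0M\<close> is a pair \<open>(a, b)\<close>, standing for
  \<open>a\<^sup>i \<partial>/\<partial>x\<^sup>i + b\<^sup>i \<partial>/\<partial>y\<^sup>i\<close>.\<close>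

definition tangent_structure :: "'e::euclidean_space \<times> 'e \<Rightarrow> 'e \<times> 'e \<Rightarrow> 'e \<times> 'e" where
  "tangent_structure z w = (0, fst w)"

definition liouville :: "'e::euclidean_space \<times> 'e \<Rightarrow> 'e \<times> 'e" where
  "liouville z = (0, snd z)"

definition horizontal_proj ::
  "('e::euclidean_space \<times> 'e \<Rightarrow> 'e \<times> 'e) \<Rightarrow> 'e \<times> 'e \<Rightarrow> 'e \<times> 'e \<Rightarrow> 'e \<times> 'e" where
  "horizontal_proj S = (\<lambda>z w. (1/2) *\<^sub>R (w - lie_deriv S tangent_structure z w))"

definition vertical_proj ::
  "('e::euclidean_space \<times> 'e \<Rightarrow> 'e \<times> 'e) \<Rightarrow> 'e \<times> 'e \<Rightarrow> 'e \<times> 'e \<Rightarrow> 'e \<times> 'e" where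
  "vertical_proj S = (\<lambda>z w. (1/2) *\<^sub>R (w + lie_deriv S tangent_structure z w))"

definition jacobi_endo ::
  "('e::euclidean_space \<times> 'e \<Rightarrow> 'e \<times> 'e) \<Rightarrow> 'e \<times> 'e \<Rightarrow> 'e \<times> 'e \<Rightarrow> 'e \<times> 'e" where
  "jacobi_endo S = (\<lambda>z w. vertical_proj S z (lie_deriv S (horizontal_proj S) z w))"

text \<open>For a semi-basic \<open>L = L\<^sup>i\<^sub>j \<partial>/\<partial>y\<^sup>i \<otimes> dx\<^sup>j\<close> the trace is \<open>L\<^sup>i\<^sub>i\<close>, which pairs \<open>dx\<^sup>i\<close> with
  \<open>\<partial>/\<partial>y\<^sup>i\<close>; as an endomorphism of the \<open>2n\<close>-dimensional tangent space such an \<open>L\<close> is nilpotent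
  and its ordinary trace is zero.\<close>

definition semibasic_trace ::
  "('e::euclidean_space \<times> 'e \<Rightarrow> 'e \<times> 'e \<Rightarrow> 'e \<times> 'e) \<Rightarrow> 'e \<times> 'e \<Rightarrow> real" where
  "semibasic_trace L = (\<lambda>z. \<Sum>b\<in>Basis. snd (L z (b, 0)) \<bullet> b)"

text \<open>From here on \<open>S\<close> is a vector field on \<open>T\<^sub>0M\<close> and \<open>F\<close> a function on \<open>TM\<close>; \<open>A\<close> is the atlas
  of \<open>M\<close>.\<close>

definition spray ::
  "('i, 'a, 'e::euclidean_space) atlas \<Rightarrow> ('a \<times> ('i \<Rightarrow> 'e) \<Rightarrow> 'i \<Rightarrow> 'e \<times> 'e) \<Rightarrow> bool" where
  "spray A S \<longleftrightarrow> smooth_vector_field (slit_tangent_bundle A) S \<and>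
     (\<forall>i\<in>Index A. \<forall>z\<in>chart_image (slit_tangent_bundle A) i.
        let S\<^sub>i = field_rep (slit_tangent_bundle A) S i in
        tangent_structure z (S\<^sub>i z) = liouville z \<and> bracket liouville S\<^sub>i z = S\<^sub>i z)"

text \<open>The Jacobi endomorphism and the Ricci curvature of a spray in the \<open>i\<close>-th induced chart.\<close>

definition Jacobi_rep ::
  "('i, 'a, 'e::euclidean_space) atlas \<Rightarrow> ('a \<times> ('i \<Rightarrow> 'e) \<Rightarrow> 'i \<Rightarrow> 'e \<times> 'e) \<Rightarrow>
     'i \<Rightarrow> 'e \<times> 'e \<Rightarrow> 'e \<times> 'e \<Rightarrow> 'e \<times> 'e" where
  "Jacobi_rep A S i = jacobi_endo (field_rep (slit_tangent_bundle A) S i)"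

definition Ric_rep ::
  "('i, 'a, 'e::euclidean_space) atlas \<Rightarrow> ('a \<times> ('i \<Rightarrow> 'e) \<Rightarrow> 'i \<Rightarrow> 'e \<times> 'e) \<Rightarrow>
     'i \<Rightarrow> 'e \<times> 'e \<Rightarrow> real" where
  "Ric_rep A S i = semibasic_trace (Jacobi_rep A S i)"

definition h_rep ::
  "('i, 'a, 'e::euclidean_space) atlas \<Rightarrow> ('a \<times> ('i \<Rightarrow> 'e) \<Rightarrow> 'i \<Rightarrow> 'e \<times> 'e) \<Rightarrow>
     'i \<Rightarrow> 'e \<times> 'e \<Rightarrow> 'e \<times> 'e \<Rightarrow> 'e \<times> 'e" where
  "h_rep A S i = horizontal_proj (field_rep (slit_tangent_bundle A) S i)"


section \<open>Finsler functions\<close>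

definition fundamental_tensor ::
  "((real^'n) \<times> (real^'n) \<Rightarrow> real) \<Rightarrow> (real^'n) \<times> (real^'n) \<Rightarrow> real^'n^'n" where
  "fundamental_tensor F = (\<lambda>z. \<chi> i j.
     (1/2) * frechet_derivative
               (\<lambda>x. frechet_derivative (\<lambda>x'. (F x')\<^sup>2) (at x) (0, axis j 1)) (at z) (0, axis i 1))"

definition finsler_function ::
  "('i, 'a, real^'n) atlas \<Rightarrow> ('a \<times> ('i \<Rightarrow> real^'n) \<Rightarrow> real) \<Rightarrow> bool" where
  "finsler_function A F \<longleftrightarrow>
     continuous_fun (tangent_bundle A) F \<and>
     smooth_fun (slit_tangent_bundle A) F \<and>
     (\<forall>q\<in>points (slit_tangent_bundle A). F q > 0) \<and>
     (\<forall>(p, v)\<in>points (tangent_bundle A). \<forall>t\<ge>0. F (p, \<lambda>i. t *\<^sub>R v i) = t * F (p, v)) \<and>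
     (\<forall>i\<in>Index A. \<forall>z\<in>chart_image (slit_tangent_bundle A) i.
        rank (fundamental_tensor (fun_rep (slit_tangent_bundle A) F i) z) = CARD('n))"

text \<open>\<open>i\<^sub>S d d\<^sub>J F\<^sup>2 = - dF\<^sup>2\<close> on \<open>T\<^sub>0M\<close>.\<close>

definition metrizable_by ::
  "('i, 'a, 'e::euclidean_space) atlas \<Rightarrow> ('a \<times> ('i \<Rightarrow> 'e) \<Rightarrow> 'i \<Rightarrow> 'e \<times> 'e) \<Rightarrow>
     ('a \<times> ('i \<Rightarrow> 'e) \<Rightarrow> real) \<Rightarrow> bool" where
  "metrizable_by A S F \<longleftrightarrow>
     (\<forall>i\<in>Index A. \<forall>z\<in>chart_image (slit_tangent_bundle A) i. \<forall>w.
        let S\<^sub>i = field_rep (slit_tangent_bundle A) S i;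
            E = (\<lambda>x. (fun_rep (slit_tangent_bundle A) F i x)\<^sup>2)
        in d1 (dL tangent_structure E) z (S\<^sub>i z) w = - d0 E z w)"

text \<open>\<open>\<Phi> = \<kappa> (F\<^sup>2 J - F d\<^sub>JF \<otimes> \<C>)\<close>, where \<open>S\<close> is meant to be the geodesic spray of \<open>F\<close>.\<close>

definition constant_flag_curvature ::
  "('i, 'a, 'e::euclidean_space) atlas \<Rightarrow> ('a \<times> ('i \<Rightarrow> 'e) \<Rightarrow> 'i \<Rightarrow> 'e \<times> 'e) \<Rightarrow>
     ('a \<times> ('i \<Rightarrow> 'e) \<Rightarrow> real) \<Rightarrow> real \<Rightarrow> bool" where
  "constant_flag_curvature A S F \<kappa> \<longleftrightarrow>
     (\<forall>i\<in>Index A. \<forall>z\<in>chart_image (slit_tangent_bundle A) i. \<forall>w.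
        let F\<^sub>i = fun_rep (slit_tangent_bundle A) F i
        in Jacobi_rep A S i z w =
             \<kappa> *\<^sub>R ((F\<^sub>i z)\<^sup>2 *\<^sub>R tangent_structure z w
                    - (F\<^sub>i z * dL tangent_structure F\<^sub>i z w) *\<^sub>R liouville z))"

end

theory Submission
  imports Defs
begin

text \<open>If \<open>\<Phi> = \<kappa> (F\<^sup>2 J - F d\<^sub>JF \<otimes> \<C>)\<close>, then taking the trace and using \<open>\<C>F = F\<close> gives
  \<open>Tr \<Phi> = \<kappa> (n - 1) F\<^sup>2\<close>. So \<open>F\<^sup>2\<close> is a constant multiple of the Ricci curvature, and every statement about
  \<open>F\<^sup>2\<close> is one about \<open>Tr \<Phi>\<close>. Under this proportionality the three defining properties of the
  metric turn one by one into the three conditions (\<open>local_equivalence\<close>):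

  \<^item> in the splitting into \<open>x\<close>- and \<open>y\<close>-directions, \<open>d d\<^sub>J F\<^sup>2\<close> has the fundamental tensor, up to a factor
    \<open>2\<close> and signs, in its off-diagonal blocks and \<open>0\<close> in the block of \<open>y\<close>-directions, so it has rank \<open>2n\<close> exactly where \<open>g\<close> has rank \<open>n\<close>;

  \<^item> \<open>S\<close> is the geodesic spray of \<open>F\<close> exactly when \<open>d\<^sub>h F\<^sup>2 = 0\<close>. For every \<open>E\<close> that is
    2-homogeneous in \<open>y\<close> one has \<open>i\<^sub>S d d\<^sub>J E + dE = d\<^sub>J (S E) - 2 d\<^sub>h E\<close> (\<open>cartan_identity\<close>), and
    \<open>i\<^sub>S d d\<^sub>J E = -dE\<close> as well as \<open>d\<^sub>h E = 0\<close> forces \<open>S E = 0\<close>;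

  \<^item> the formula for \<open>\<Phi>\<close> is (\<open>D\<^sub>1\<close>) divided by \<open>2(n - 1)\<close>, because \<open>2 F d\<^sub>J F = d\<^sub>J F\<^sup>2\<close>.

  Conversely, given the three conditions, put \<open>F = sqrt (\<bar>Tr \<Phi>\<bar> / (n - 1))\<close> and let \<open>\<kappa>\<close> be the sign of
  \<open>Tr \<Phi>\<close>. It has to be seen that this is a Finsler function and that \<open>\<kappa>\<close> is constant. The trace of (\<open>D\<^sub>1\<close>) is
  Euler's identity \<open>\<C>(Tr \<Phi>) = 2 Tr \<Phi>\<close>, so \<open>F\<close> is 1-homogeneous (\<open>D1_imp_euler\<close>, \<open>euler_imp_homogeneous\<close>);
  homogeneity makes the extension of \<open>F\<close> by \<open>0\<close> to the zero section continuous
  (\<open>continuous_on_homogeneous\<close>); \<open>Tr \<Phi>\<close> does not depend on the chart, as the components of \<open>\<Phi>\<close>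
  transform by conjugation with the derivative of the transition map (\<open>curv_transition\<close>,
  \<open>ricci_transition\<close>); and its sign is constant because the punctured fibres are connected for
  \<open>n \<ge> 2\<close> and \<open>M\<close> is connected (\<open>Ric_constant_sign\<close>).

  In a chart, \<open>S = (y, s)\<close> with \<open>s = -2G\<close>, and everything is expressed by directional derivatives of
  \<open>s\<close>; mixed partial derivatives are then compared by the symmetry of higher derivatives.\<close>


section \<open>Directional derivatives of smooth maps\<close>

text \<open>In \<open>dd2 f z u v\<close> the direction \<open>v\<close> is differentiated first and \<open>u\<close> last; \<open>dd3\<close> below follows the same
  order.\<close>

abbreviation dd where "dd f z \<equiv> frechet_derivative f (at z)"
abbreviation dd2 where "dd2 f z u v \<equiv> frechet_derivative (\<lambda>x. frechet_derivative f (at x) v) (at z) u"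

lemma dd_eqI: "(f has_derivative f') (at z) \<Longrightarrow> dd f z = f'"
  by (metis frechet_derivative_at)

lemma has_derivative_dd: "f differentiable (at z) \<Longrightarrow> (f has_derivative dd f z) (at z)"
  by (simp add: frechet_derivative_works)

lemma has_derivative_cong_open:
  assumes "open W" "z \<in> W" "\<And>x. x \<in> W \<Longrightarrow> f x = g x"
  shows "(f has_derivative f') (at z) \<longleftrightarrow> (g has_derivative f') (at z)"
proof
  show "(g has_derivative f') (at z)" if "(f has_derivative f') (at z)"
    by (rule has_derivative_transform_within_open[OF that]) (use assms in auto)
  show "(f has_derivative f') (at z)" if "(g has_derivative f') (at z)"
    by (rule has_derivative_transform_within_open[OF that]) (use assms in auto)
qed

lemma dd_cong_open:
  assumes "open W" "z \<in> W" "\<And>x. x \<in> W \<Longrightarrow> f x = g x"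
  shows "dd f z = dd g z"
  by (simp only: frechet_derivative_def has_derivative_cong_open[OF assms])

lemma differentiable_cong_open:
  assumes "open W" "z \<in> W" "\<And>x. x \<in> W \<Longrightarrow> f x = g x"
  shows "f differentiable (at z) \<longleftrightarrow> g differentiable (at z)"
  by (simp only: differentiable_def has_derivative_cong_open[OF assms])

lemma Ck_on_cong:
  assumes "open W" "\<And>x. x \<in> W \<Longrightarrow> f x = g x"
  shows "Ck_on k W f \<longleftrightarrow> Ck_on k W g"
  using assms(2)
proof (induction k arbitrary: f g)
  case 0 then show ?case using continuous_on_cong[OF refl] by (simp only: Ck_on.simps) blast
next
  case (Suc k)
  have "Ck_on k W (\<lambda>x. dd f x v) = Ck_on k W (\<lambda>x. dd g x v)" for v
    by (rule Suc.IH) (use dd_cong_open[OF assms(1) _ Suc.prems] in auto)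
  moreover have "(\<forall>x\<in>W. f differentiable at x) = (\<forall>x\<in>W. g differentiable at x)"
    using differentiable_cong_open[OF assms(1) _ Suc.prems] by auto
  ultimately show ?case by simp
qed

lemma Ck_on_Suc_imp: "Ck_on (Suc k) W f \<Longrightarrow> Ck_on k W f"
proof (induction k arbitrary: f)
  case 0 then show ?case
    by (auto intro!: continuous_at_imp_continuous_on differentiable_imp_continuous_within)
next
  case (Suc k) then show ?case by simp
qed

lemma Ck_on_const: "Ck_on k W (\<lambda>x. c)"
  by (induction k arbitrary: c) auto

lemma Ck_on_add:
  assumes "open W"
  shows "Ck_on k W f \<Longrightarrow> Ck_on k W g \<Longrightarrow> Ck_on k W (\<lambda>x. f x + g x)"
proof (induction k arbitrary: f g)
  case 0 then show ?case by (simp add: continuous_on_add)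
next
  case (Suc k)
  have d: "((\<lambda>x. f x + g x) has_derivative (\<lambda>v. dd f x v + dd g x v)) (at x)" if "x \<in> W" for x
    using Suc.prems that by (intro has_derivative_add has_derivative_dd) simp_all
  have "Ck_on k W (\<lambda>x. dd f x v + dd g x v)" for v
    by (rule Suc.IH) (use Suc.prems in simp_all)
  then have "Ck_on k W (\<lambda>x. dd (\<lambda>x. f x + g x) x v)" for v
    by (subst Ck_on_cong[OF assms, where g="\<lambda>x. dd f x v + dd g x v"]) (simp_all add: dd_eqI[OF d])
  then show ?case using d by (auto simp only: Ck_on.simps differentiable_def)
qed

lemma Ck_on_bounded_linear:
  assumes "open W" "bounded_linear L"
  shows "Ck_on k W f \<Longrightarrow> Ck_on k W (\<lambda>x. L (f x))"
proof (induction k arbitrary: f)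
  case 0 then show ?case by (simp add: bounded_linear.continuous_on[OF assms(2)])
next
  case (Suc k)
  have d: "((\<lambda>x. L (f x)) has_derivative (\<lambda>v. L (dd f x v))) (at x)" if "x \<in> W" for x
    by (intro bounded_linear.has_derivative[OF assms(2)] has_derivative_dd) (use Suc.prems that in auto)
  have "Ck_on k W (\<lambda>x. L (dd f x v))" for v
    by (rule Suc.IH) (use Suc.prems in simp_all)
  then have "Ck_on k W (\<lambda>x. dd (\<lambda>x. L (f x)) x v)" for v
    by (subst Ck_on_cong[OF assms(1), where g="\<lambda>x. L (dd f x v)"]) (simp_all add: dd_eqI[OF d])
  then show ?case using d by (auto simp only: Ck_on.simps differentiable_def)
qed

lemma Ck_on_bilinear:
  assumes "open W" "bounded_bilinear B"
  shows "Ck_on k W f \<Longrightarrow> Ck_on k W g \<Longrightarrow> Ck_on k W (\<lambda>x. B (f x) (g x))"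
proof (induction k arbitrary: f g)
  case 0 then show ?case by (simp add: bounded_bilinear.continuous_on[OF assms(2)])
next
  case (Suc k)
  have d: "((\<lambda>x. B (f x) (g x)) has_derivative (\<lambda>v. B (f x) (dd g x v) + B (dd f x v) (g x))) (at x)"
    if "x \<in> W" for x
    by (intro bounded_bilinear.FDERIV[OF assms(2)] has_derivative_dd) (use Suc.prems that in auto)
  have "Ck_on k W (\<lambda>x. B (f x) (dd g x v) + B (dd f x v) (g x))" for v
    by (intro Ck_on_add[OF assms(1)]; rule Suc.IH)
      (use Suc.prems Ck_on_Suc_imp[OF Suc.prems(1)] Ck_on_Suc_imp[OF Suc.prems(2)] in simp_all)
  then have "Ck_on k W (\<lambda>x. dd (\<lambda>x. B (f x) (g x)) x v)" for v
    by (subst Ck_on_cong[OF assms(1), where g="\<lambda>x. B (f x) (dd g x v) + B (dd f x v) (g x)"])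
      (simp_all add: dd_eqI[OF d])
  then show ?case using d by (auto simp only: Ck_on.simps differentiable_def)
qed

text \<open>Smoothness of the square root is proved for all real exponents at once, since
  differentiation lowers the exponent.\<close>

lemma Ck_on_powr:
  fixes f :: "'e::real_normed_vector \<Rightarrow> real"
  assumes "open W" "\<And>x. x \<in> W \<Longrightarrow> f x > 0"
  shows "Ck_on k W f \<Longrightarrow> Ck_on k W (\<lambda>x. f x powr p)"
proof (induction k arbitrary: p)
  case 0 then show ?case
    using assms(2) by (force intro!: continuous_on_powr continuous_on_const)
next
  case (Suc k)
  have d: "((\<lambda>x. f x powr p) has_derivative (\<lambda>v. p * (f x powr (p - 1) * dd f x v))) (at x)"
    if "x \<in> W" for x
  proof -
    have "(f has_derivative dd f x) (at x)" using Suc.prems that has_derivative_dd by auto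
    from has_derivative_compose[OF this, of "\<lambda>y. y powr p" "(*) (p * f x powr (p - 1))"]
      has_real_derivative_powr[OF assms(2)[OF that], of p]
    show ?thesis by (simp add: has_field_derivative_def mult.assoc)
  qed
  have "Ck_on k W (\<lambda>x. f x powr (p - 1) * dd f x v)" for v
    by (rule Ck_on_bilinear[OF assms(1) bounded_bilinear_mult Suc.IH[OF Ck_on_Suc_imp[OF Suc.prems]]])
      (use Suc.prems in simp)
  then have "Ck_on k W (\<lambda>x. p * (f x powr (p - 1) * dd f x v))" for v
    by (rule Ck_on_bilinear[OF assms(1) bounded_bilinear_mult Ck_on_const])
  then have "Ck_on k W (\<lambda>x. dd (\<lambda>x. f x powr p) x v)" for v
    by (subst Ck_on_cong[OF assms(1), where g="\<lambda>x. p * (f x powr (p - 1) * dd f x v)"])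
      (simp_all add: dd_eqI[OF d])
  then show ?case using d by (auto simp only: Ck_on.simps differentiable_def)
qed

lemma smooth_on_cong:
  "open W \<Longrightarrow> (\<And>x. x \<in> W \<Longrightarrow> f x = g x) \<Longrightarrow> smooth_on W f \<longleftrightarrow> smooth_on W g"
  unfolding smooth_on_def using Ck_on_cong by blast

lemma smooth_on_differentiable: "smooth_on W f \<Longrightarrow> z \<in> W \<Longrightarrow> f differentiable (at z)"
  unfolding smooth_on_def by (metis Ck_on.simps(2))

lemma smooth_on_has_derivative: "smooth_on W f \<Longrightarrow> z \<in> W \<Longrightarrow> (f has_derivative dd f z) (at z)"
  by (simp add: has_derivative_dd smooth_on_differentiable)

lemma smooth_on_dd: "smooth_on W f \<Longrightarrow> smooth_on W (\<lambda>x. dd f x v)"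
  unfolding smooth_on_def by (metis Ck_on.simps(2))

lemma smooth_on_continuous: "smooth_on W f \<Longrightarrow> continuous_on W f"
  unfolding smooth_on_def by (metis Ck_on.simps(1))

lemma smooth_on_const: "smooth_on W (\<lambda>x. c)"
  by (simp add: smooth_on_def Ck_on_const)

lemma smooth_on_add:
  "open W \<Longrightarrow> smooth_on W f \<Longrightarrow> smooth_on W g \<Longrightarrow> smooth_on W (\<lambda>x. f x + g x)"
  by (simp add: smooth_on_def Ck_on_add)

lemma smooth_on_bounded_linear:
  "open W \<Longrightarrow> bounded_linear L \<Longrightarrow> smooth_on W f \<Longrightarrow> smooth_on W (\<lambda>x. L (f x))"
  by (simp add: smooth_on_def Ck_on_bounded_linear)

lemma smooth_on_bilinear:
  "open W \<Longrightarrow> bounded_bilinear B \<Longrightarrow> smooth_on W f \<Longrightarrow> smooth_on W g \<Longrightarrow>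
     smooth_on W (\<lambda>x. B (f x) (g x))"
  by (simp add: smooth_on_def Ck_on_bilinear)

lemma smooth_on_powr:
  fixes f :: "'e::real_normed_vector \<Rightarrow> real"
  shows "open W \<Longrightarrow> smooth_on W f \<Longrightarrow> (\<And>x. x \<in> W \<Longrightarrow> f x > 0) \<Longrightarrow> smooth_on W (\<lambda>x. f x powr p)"
  by (simp add: smooth_on_def Ck_on_powr)

lemma smooth_on_sum:
  assumes "open W" "\<And>i. i \<in> I \<Longrightarrow> smooth_on W (f i)"
  shows "smooth_on W (\<lambda>x. \<Sum>i\<in>I. f i x)"
  using assms(2) by (induction I rule: infinite_finite_induct)
    (auto intro: smooth_on_const smooth_on_add[OF assms(1)])

lemma smooth_on_diff:
  "open W \<Longrightarrow> smooth_on W f \<Longrightarrow> smooth_on W g \<Longrightarrow> smooth_on W (\<lambda>x. f x - g x)"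
  using smooth_on_add[of W f "\<lambda>x. - g x"] smooth_on_bounded_linear[of W uminus g]
  by (simp add: bounded_linear_minus bounded_linear_ident)

lemma dd_linear: "smooth_on W f \<Longrightarrow> z \<in> W \<Longrightarrow> linear (dd f z)"
  by (simp add: linear_frechet_derivative smooth_on_differentiable)

lemma dd_basis_sum:
  fixes f :: "'e::euclidean_space \<Rightarrow> 'f::real_normed_vector"
  assumes "smooth_on W f" "z \<in> W"
  shows "dd f z v = (\<Sum>b\<in>Basis. (v \<bullet> b) *\<^sub>R dd f z b)"
proof -
  interpret linear "dd f z" by (rule dd_linear[OF assms])
  have "dd f z (\<Sum>b\<in>Basis. (v \<bullet> b) *\<^sub>R b) = (\<Sum>b\<in>Basis. (v \<bullet> b) *\<^sub>R dd f z b)"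
    by (simp add: sum scale)
  then show ?thesis by (simp add: euclidean_representation)
qed

text \<open>A direction that varies with the base point is expanded in the standard basis, which
  reduces to the constant directions for which \<open>smooth_on\<close> is defined.\<close>

lemma smooth_on_dd_along:
  fixes f :: "'e::euclidean_space \<Rightarrow> 'f::real_normed_vector"
  assumes "open W" "smooth_on W f" "smooth_on W V"
  shows "smooth_on W (\<lambda>x. dd f x (V x))"
proof -
  have "smooth_on W (\<lambda>x. \<Sum>b\<in>Basis. (V x \<bullet> b) *\<^sub>R dd f x b)"
    using assms by (intro smooth_on_sum smooth_on_bilinear[OF _ bounded_bilinear_scaleR]
        smooth_on_bounded_linear[OF _ bounded_linear_inner_left] smooth_on_dd) auto
  then show ?thesis
    by (subst smooth_on_cong[OF assms(1)]) (auto simp: dd_basis_sum[OF assms(2), of _ "V _"])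
qed

text \<open>Schwarz's theorem. The second difference of \<open>f\<close> over a small parallelogram with sides
  \<open>h u\<close>, \<open>h v\<close> is, by two applications of the mean value theorem, \<open>h\<^sup>2\<close> times a value of either mixed
  derivative near \<open>z\<close>. Were the mixed derivatives different at \<open>z\<close>, continuity would keep their nearby
  values apart.\<close>

lemma dd_swap_real:
  fixes f :: "'e::real_normed_vector \<Rightarrow> real"
  assumes W: "open W" and f: "smooth_on W f" and z: "z \<in> W"
  shows "dd2 f z u v = dd2 f z v u"
proof (rule ccontr)
  define p q where "p = (\<lambda>x. dd2 f x u v)" and "q = (\<lambda>x. dd2 f x v u)"
  assume "\<not> ?thesis"
  then have e: "0 < \<bar>p z - q z\<bar> / 2" (is "0 < ?e") by (simp add: p_def q_def)
  have cont: "isCont (\<lambda>x. dd2 f x a b) z" for a b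
    by (rule continuous_on_interior[OF smooth_on_continuous[OF smooth_on_dd[OF smooth_on_dd[OF f]]]])
      (use W z in \<open>simp add: interior_open\<close>)
  have near_z: "\<exists>d>0. \<forall>x. dist x z < d \<longrightarrow> \<bar>g x - g z\<bar> < ?e" if "isCont g z" for g :: "'e \<Rightarrow> real"
    using that[unfolded continuous_at_eps_delta dist_real_def, rule_format, OF e] by simp
  have pc: "isCont p z" unfolding p_def by (rule cont)
  have qc: "isCont q z" unfolding q_def by (rule cont)
  obtain d1 where d1: "d1 > 0" "\<And>x. dist x z < d1 \<Longrightarrow> \<bar>p x - p z\<bar> < ?e"
    using near_z[OF pc] by metis
  obtain d2 where d2: "d2 > 0" "\<And>x. dist x z < d2 \<Longrightarrow> \<bar>q x - q z\<bar> < ?e"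
    using near_z[OF qc] by metis
  obtain d3 where d3: "d3 > 0" "ball z d3 \<subseteq> W" using W z open_contains_ball by blast
  define r where "r = min d1 (min d2 d3)"
  \<comment> \<open>the parallelogram stays within distance \<open>r/2\<close> of \<open>z\<close>; the \<open>1\<close> covers \<open>u = v = 0\<close>\<close>
  define h where "h = r / (2 * (norm u + norm v + 1))"
  have r: "r > 0" using d1 d2 d3 by (simp add: r_def)
  have h: "h > 0" using r by (simp add: h_def add_nonneg_pos)
  have near: "dist (z + s *\<^sub>R u + t *\<^sub>R v) z < r" if "0 \<le> s" "s \<le> h" "0 \<le> t" "t \<le> h" for s t
  proof -
    have "dist (z + s *\<^sub>R u + t *\<^sub>R v) z \<le> s * norm u + t * norm v"
      using that norm_triangle_ineq[of "s *\<^sub>R u" "t *\<^sub>R v"] by (simp add: dist_norm add.assoc)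
    also have "\<dots> \<le> h * norm u + h * norm v" using that by (intro add_mono mult_right_mono) auto
    also have "\<dots> = r / 2 * ((norm u + norm v) / (norm u + norm v + 1))"
      by (simp add: h_def distrib_left add_divide_distrib)
    also have "\<dots> \<le> r / 2 * 1" using r by (intro mult_left_mono) (auto simp: divide_le_eq_1 add_nonneg_pos)
    also have "\<dots> < r" using r by simp
    finally show ?thesis .
  qed
  have inW: "z + s *\<^sub>R u + t *\<^sub>R v \<in> W" if "0 \<le> s" "s \<le> h" "0 \<le> t" "t \<le> h" for s t
  proof -
    have "dist (z + s *\<^sub>R u + t *\<^sub>R v) z < d3" using near[OF that] by (simp add: r_def)
    then show ?thesis using d3 by (auto simp: dist_commute)
  qed
  have along: "((\<lambda>s. g (a + s *\<^sub>R w)) has_derivative (\<lambda>k. k * dd g (a + s *\<^sub>R w) w)) (at s)"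
    if "smooth_on W g" "a + s *\<^sub>R w \<in> W" for g :: "'e \<Rightarrow> real" and a w s
  proof -
    have "((\<lambda>s. a + s *\<^sub>R w) has_derivative (\<lambda>k. k *\<^sub>R w)) (at s)"
      by (auto intro!: derivative_eq_intros)
    from has_derivative_compose[OF this smooth_on_has_derivative[OF that]]
    show ?thesis
      using linear_scale[OF dd_linear[OF that]] by simp
  qed
  have mvt: "\<exists>s. 0 < s \<and> s < h \<and> g h - g 0 = h * g' s"
    if "\<And>s. 0 \<le> s \<Longrightarrow> s \<le> h \<Longrightarrow> (g has_derivative (\<lambda>k. k * g' s)) (at s)" for g g' :: "real \<Rightarrow> real"
  proof -
    have "\<exists>x\<in>{0<..<h}. g h - g 0 = (h - 0) * g' x"
      by (rule mvt_simple[OF h]) (use that in \<open>auto intro: has_derivative_at_withinI\<close>)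
    then show ?thesis by auto
  qed
  have key: "\<exists>s t. 0 < s \<and> s < h \<and> 0 < t \<and> t < h \<and>
      f (z + h *\<^sub>R a + h *\<^sub>R b) - f (z + h *\<^sub>R a) - f (z + h *\<^sub>R b) + f z =
      h * h * dd2 f (z + s *\<^sub>R a + t *\<^sub>R b) b a"
    if ab: "\<And>s t. 0 \<le> s \<Longrightarrow> s \<le> h \<Longrightarrow> 0 \<le> t \<Longrightarrow> t \<le> h \<Longrightarrow> z + s *\<^sub>R a + t *\<^sub>R b \<in> W" for a b
  proof -
    let ?g = "\<lambda>s. f ((z + h *\<^sub>R b) + s *\<^sub>R a) - f (z + s *\<^sub>R a)"
    let ?g' = "\<lambda>s. dd f ((z + h *\<^sub>R b) + s *\<^sub>R a) a - dd f (z + s *\<^sub>R a) a"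
    have "(?g has_derivative (\<lambda>k. k * ?g' s)) (at s)" if s: "0 \<le> s" "s \<le> h" for s
    proof -
      have "z + h *\<^sub>R b + s *\<^sub>R a \<in> W" "z + s *\<^sub>R a \<in> W"
        using ab[OF s, of h] ab[OF s, of 0] h by (auto simp: algebra_simps)
      from has_derivative_diff[OF along[OF f this(1)] along[OF f this(2)]]
      show ?thesis by (simp add: algebra_simps)
    qed
    from mvt[OF this] obtain s where s: "0 < s" "s < h" "?g h - ?g 0 = h * ?g' s" by blast
    have "((\<lambda>t. dd f (z + s *\<^sub>R a + t *\<^sub>R b) a) has_derivative
        (\<lambda>k. k * dd2 f (z + s *\<^sub>R a + t *\<^sub>R b) b a)) (at t)" if t: "0 \<le> t" "t \<le> h" for t
      by (rule along[OF smooth_on_dd[OF f]]) (use ab s t in auto)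
    from mvt[OF this] obtain t where t: "0 < t" "t < h"
      "dd f (z + s *\<^sub>R a + h *\<^sub>R b) a - dd f (z + s *\<^sub>R a) a = h * dd2 f (z + s *\<^sub>R a + t *\<^sub>R b) b a"
      by auto
    have "f (z + h *\<^sub>R a + h *\<^sub>R b) - f (z + h *\<^sub>R a) - f (z + h *\<^sub>R b) + f z = ?g h - ?g 0"
      by (simp add: algebra_simps)
    also have "\<dots> = h * (dd f (z + s *\<^sub>R a + h *\<^sub>R b) a - dd f (z + s *\<^sub>R a) a)"
      using s(3) by (simp add: algebra_simps)
    finally show ?thesis using s t by (intro exI[of _ s] exI[of _ t]) simp
  qed
  obtain s t where st: "0 < s" "s < h" "0 < t" "t < h"
      "f (z + h *\<^sub>R u + h *\<^sub>R v) - f (z + h *\<^sub>R u) - f (z + h *\<^sub>R v) + f z = h * h * q (z + s *\<^sub>R u + t *\<^sub>R v)"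
    using key[of u v] inW unfolding q_def by blast
  have inW': "z + s *\<^sub>R v + t *\<^sub>R u \<in> W" if "0 \<le> s" "s \<le> h" "0 \<le> t" "t \<le> h" for s t
    using inW[OF that(3,4,1,2)] by (simp add: algebra_simps)
  obtain s' t' where st': "0 < s'" "s' < h" "0 < t'" "t' < h"
      "f (z + h *\<^sub>R v + h *\<^sub>R u) - f (z + h *\<^sub>R v) - f (z + h *\<^sub>R u) + f z = h * h * p (z + s' *\<^sub>R v + t' *\<^sub>R u)"
    using key[of v u] inW' unfolding p_def by blast
  have "h * h * q (z + s *\<^sub>R u + t *\<^sub>R v) = h * h * p (z + t' *\<^sub>R u + s' *\<^sub>R v)"
    unfolding st(5)[symmetric] using st'(5) by (simp add: algebra_simps)
  then have eq: "q (z + s *\<^sub>R u + t *\<^sub>R v) = p (z + t' *\<^sub>R u + s' *\<^sub>R v)" using h by simp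
  have "\<bar>p (z + t' *\<^sub>R u + s' *\<^sub>R v) - p z\<bar> < ?e" "\<bar>q (z + s *\<^sub>R u + t *\<^sub>R v) - q z\<bar> < ?e"
    using d1(2)[of "z + t' *\<^sub>R u + s' *\<^sub>R v"] d2(2)[of "z + s *\<^sub>R u + t *\<^sub>R v"] near[of t' s'] near[of s t] st st'
    by (auto simp: r_def)
  then show False unfolding eq by (simp add: abs_if split: if_splits)
qed

lemma dd_swap:
  fixes f :: "'e::real_normed_vector \<Rightarrow> 'f::euclidean_space"
  assumes W: "open W" and f: "smooth_on W f" and z: "z \<in> W"
  shows "dd2 f z u v = dd2 f z v u"
proof (rule euclidean_eqI)
  fix b :: 'f
  have inner: "dd (\<lambda>x. g x \<bullet> b) x w = dd g x w \<bullet> b" if "smooth_on W g" "x \<in> W" for g :: "'e \<Rightarrow> 'f" and x w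
    using dd_eqI[OF has_derivative_inner_left[OF smooth_on_has_derivative[OF that]]] by simp
  have 2: "dd2 (\<lambda>x. f x \<bullet> b) z u v = dd2 f z u v \<bullet> b" for u v
  proof -
    have "dd2 (\<lambda>x. f x \<bullet> b) z u v = dd (\<lambda>x. dd f x v \<bullet> b) z u"
      by (subst dd_cong_open[OF W z, of "\<lambda>x. dd (\<lambda>x. f x \<bullet> b) x v"]) (use inner[OF f] in auto)
    then show ?thesis using inner[OF smooth_on_dd[OF f] z] by simp
  qed
  show "dd2 f z u v \<bullet> b = dd2 f z v u \<bullet> b"
    unfolding 2[symmetric]
    by (rule dd_swap_real[OF W _ z]) (use smooth_on_bounded_linear[OF W bounded_linear_inner_left f] in auto)
qed

lemma dd2_basis_sum:
  fixes f :: "'e::euclidean_space \<Rightarrow> 'f::real_normed_vector"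
  assumes W: "open W" and f: "smooth_on W f" and z: "z \<in> W"
  shows "dd2 f z u v = (\<Sum>b\<in>Basis. (v \<bullet> b) *\<^sub>R dd2 f z u b)"
proof -
  have "dd2 f z u v = dd (\<lambda>x. \<Sum>b\<in>Basis. (v \<bullet> b) *\<^sub>R dd f x b) z u"
    by (subst dd_cong_open[OF W z, of "\<lambda>x. dd f x v"]) (use dd_basis_sum[OF f] in auto)
  also have "\<dots> = (\<Sum>b\<in>Basis. (v \<bullet> b) *\<^sub>R dd2 f z u b)"
    by (subst dd_eqI[OF has_derivative_sum[OF has_derivative_scaleR_right[OF
      smooth_on_has_derivative[OF smooth_on_dd[OF f] z]]]]) auto
  finally show ?thesis .
qed

text \<open>The chain rule for \<open>x \<mapsto> Df(\<Phi> x)(V x)\<close>: the tool by which identities between derivatives,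
  such as Euler's identity or the transformation law of a spray, are differentiated again.\<close>

lemma has_derivative_dd_along:
  fixes f :: "'e::euclidean_space \<Rightarrow> 'f::real_normed_vector"
  assumes W: "open W" and f: "smooth_on W f" and z: "\<Phi> z \<in> W"
    and \<Phi>: "(\<Phi> has_derivative \<Phi>') (at z)" and V: "(V has_derivative V') (at z)"
  shows "((\<lambda>x. dd f (\<Phi> x) (V x)) has_derivative (\<lambda>u. dd2 f (\<Phi> z) (\<Phi>' u) (V z) + dd f (\<Phi> z) (V' u))) (at z)"
proof -
  let ?g = "\<lambda>x. \<Sum>b\<in>Basis. (V x \<bullet> b) *\<^sub>R dd f (\<Phi> x) b"
  have *: "((\<lambda>x. dd f (\<Phi> x) b) has_derivative (\<lambda>u. dd2 f (\<Phi> z) (\<Phi>' u) b)) (at z)" for b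
    by (rule has_derivative_compose[OF \<Phi> smooth_on_has_derivative[OF smooth_on_dd[OF f] z]])
  have g: "(?g has_derivative (\<lambda>u. \<Sum>b\<in>Basis. (V z \<bullet> b) *\<^sub>R dd2 f (\<Phi> z) (\<Phi>' u) b
      + (V' u \<bullet> b) *\<^sub>R dd f (\<Phi> z) b)) (at z)"
    by (intro has_derivative_sum has_derivative_scaleR has_derivative_inner_left V *)
  note lin = dd2_basis_sum[OF W f z, where v="V z"]
  have g': "(?g has_derivative (\<lambda>u. dd2 f (\<Phi> z) (\<Phi>' u) (V z) + dd f (\<Phi> z) (V' u))) (at z)"
    using g by (simp add: lin dd_basis_sum[OF f z, of "V' _"] sum.distrib)
  have "eventually (\<lambda>x. \<Phi> x \<in> W) (at z)"
    using has_derivative_continuous[OF \<Phi>] z W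
    by (auto simp: continuous_within intro: topological_tendstoD)
  then have "eventually (\<lambda>x. ?g x = dd f (\<Phi> x) (V x)) (at z)"
    by eventually_elim (use dd_basis_sum[OF f] in simp)
  from has_derivative_transform_eventually[OF g' this] show ?thesis
    using dd_basis_sum[OF f z, of "V z"] by simp
qed

abbreviation dd3 where "dd3 f z u v w \<equiv> dd2 (\<lambda>x. frechet_derivative f (at x) w) z u v"

lemma dd3_basis_sum:
  fixes f :: "'e::euclidean_space \<Rightarrow> 'f::real_normed_vector"
  assumes W: "open W" and f: "smooth_on W f" and z: "z \<in> W"
  shows "dd3 f z u v w = (\<Sum>b\<in>Basis. (w \<bullet> b) *\<^sub>R dd3 f z u v b)"
proof -
  have "dd3 f z u v w = dd (\<lambda>x. \<Sum>b\<in>Basis. (w \<bullet> b) *\<^sub>R dd2 f x v b) z u"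
    by (subst dd_cong_open[OF W z, of "\<lambda>x. dd2 f x v w"]) (use dd2_basis_sum[OF W f] in auto)
  also have "\<dots> = (\<Sum>b\<in>Basis. (w \<bullet> b) *\<^sub>R dd3 f z u v b)"
    by (subst dd_eqI[OF has_derivative_sum[OF has_derivative_scaleR_right[OF
      smooth_on_has_derivative[OF smooth_on_dd[OF smooth_on_dd[OF f]] z]]]]) auto
  finally show ?thesis .
qed

lemma has_derivative_dd2_along:
  fixes f :: "'e::euclidean_space \<Rightarrow> 'f::real_normed_vector"
  assumes W: "open W" and f: "smooth_on W f" and z: "\<Phi> z \<in> W"
    and \<Phi>: "(\<Phi> has_derivative \<Phi>') (at z)"
    and V: "(V has_derivative V') (at z)" and Y: "(Y has_derivative Y') (at z)"
  shows "((\<lambda>x. dd2 f (\<Phi> x) (V x) (Y x)) has_derivative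
    (\<lambda>u. dd3 f (\<Phi> z) (\<Phi>' u) (V z) (Y z) + dd2 f (\<Phi> z) (V' u) (Y z) + dd2 f (\<Phi> z) (V z) (Y' u))) (at z)"
proof -
  let ?g = "\<lambda>x. \<Sum>b\<in>Basis. (Y x \<bullet> b) *\<^sub>R dd2 f (\<Phi> x) (V x) b"
  have *: "((\<lambda>x. dd2 f (\<Phi> x) (V x) b) has_derivative
      (\<lambda>u. dd3 f (\<Phi> z) (\<Phi>' u) (V z) b + dd2 f (\<Phi> z) (V' u) b)) (at z)" for b
    by (rule has_derivative_dd_along[OF W smooth_on_dd[OF f] z \<Phi> V])
  have g: "(?g has_derivative (\<lambda>u. \<Sum>b\<in>Basis.
        (Y z \<bullet> b) *\<^sub>R (dd3 f (\<Phi> z) (\<Phi>' u) (V z) b + dd2 f (\<Phi> z) (V' u) b)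
      + (Y' u \<bullet> b) *\<^sub>R dd2 f (\<Phi> z) (V z) b)) (at z)"
    by (intro has_derivative_sum has_derivative_scaleR has_derivative_inner_left Y *)
  have eq: "(\<lambda>u. \<Sum>b\<in>Basis.
        (Y z \<bullet> b) *\<^sub>R (dd3 f (\<Phi> z) (\<Phi>' u) (V z) b + dd2 f (\<Phi> z) (V' u) b)
      + (Y' u \<bullet> b) *\<^sub>R dd2 f (\<Phi> z) (V z) b) =
    (\<lambda>u. dd3 f (\<Phi> z) (\<Phi>' u) (V z) (Y z) + dd2 f (\<Phi> z) (V' u) (Y z) + dd2 f (\<Phi> z) (V z) (Y' u))"
    by (simp only: dd3_basis_sum[OF W f z, where w="Y z"] dd2_basis_sum[OF W f z, where v="Y z"]
      dd2_basis_sum[OF W f z, where v="Y' _"] sum.distrib scaleR_add_right)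
  have "eventually (\<lambda>x. \<Phi> x \<in> W) (at z)"
    using has_derivative_continuous[OF \<Phi>] z W
    by (auto simp: continuous_within intro: topological_tendstoD)
  then have "eventually (\<lambda>x. ?g x = dd2 f (\<Phi> x) (V x) (Y x)) (at z)"
    by eventually_elim (use dd2_basis_sum[OF W f] in simp)
  from has_derivative_transform_eventually[OF g[unfolded eq] this] show ?thesis
    using dd2_basis_sum[OF W f z, where v="Y z" and u="V z"] by simp
qed

lemma dd3_swap:
  fixes f :: "'e::real_normed_vector \<Rightarrow> 'f::euclidean_space"
  assumes W: "open W" and f: "smooth_on W f" and z: "z \<in> W"
  shows "dd3 f z u v w = dd3 f z v u w" "dd3 f z u v w = dd3 f z u w v"
proof -
  show "dd3 f z u v w = dd3 f z v u w" by (rule dd_swap[OF W smooth_on_dd[OF f] z])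
  have "dd (\<lambda>x. dd2 f x v w) z = dd (\<lambda>x. dd2 f x w v) z"
    by (rule dd_cong_open[OF W z]) (rule dd_swap[OF W f])
  then show "dd3 f z u v w = dd3 f z u w v" by simp
qed

lemma linear_dd2_right:
  fixes f :: "'x::euclidean_space \<Rightarrow> 'f::euclidean_space"
  assumes "open V" "smooth_on V f" "z \<in> V" shows "linear (\<lambda>w. dd2 f z u w)"
proof -
  have "(\<lambda>w. dd2 f z u w) = dd (\<lambda>x. dd f x u) z"
    by (rule ext) (rule dd_swap[OF assms])
  then show ?thesis using dd_linear[OF smooth_on_dd[OF assms(2)] assms(3)] by metis
qed

section \<open>A spray in a chart\<close>

text \<open>The integral curves of \<open>S\<close> solve \<open>x'' = accel S (x, x')\<close>; in the usual notation \<open>accel S = -2G\<close>.\<close>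

definition accel :: "('e::euclidean_space \<times> 'e \<Rightarrow> 'e \<times> 'e) \<Rightarrow> 'e \<times> 'e \<Rightarrow> 'e" where
  "accel S z = snd (S z)"

text \<open>The coefficients \<open>-\<partial>G\<^sup>i/\<partial>y\<^sup>j\<close> of the nonlinear connection; the sign makes \<open>(w, nonlin S z w)\<close> the
  horizontal lift of \<open>w\<close>.\<close>

definition nonlin :: "('e::euclidean_space \<times> 'e \<Rightarrow> 'e \<times> 'e) \<Rightarrow> 'e \<times> 'e \<Rightarrow> 'e \<Rightarrow> 'e" where
  "nonlin S z w = (1/2) *\<^sub>R dd (accel S) z (0, w)"

text \<open>The components \<open>R\<^sup>i\<^sub>j = 2 \<partial>G\<^sup>i/\<partial>x\<^sup>j - S(\<partial>G\<^sup>i/\<partial>y\<^sup>j) - (\<partial>G\<^sup>i/\<partial>y\<^sup>r)(\<partial>G\<^sup>r/\<partial>y\<^sup>j)\<close> of the Jacobi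
  endomorphism, with \<open>G = -accel S / 2\<close>.\<close>

definition curv :: "('e::euclidean_space \<times> 'e \<Rightarrow> 'e \<times> 'e) \<Rightarrow> 'e \<times> 'e \<Rightarrow> 'e \<Rightarrow> 'e" where
  "curv S z w = (1/2) *\<^sub>R dd2 (accel S) z (S z) (0, w) - dd (accel S) z (w, 0) - nonlin S z (nonlin S z w)"

text \<open>The chart image of the slit tangent bundle over a chart with image \<open>U\<close> is \<open>U \<times> -{0}\<close>.\<close>

locale local_spray =
  fixes U :: "'e::euclidean_space set" and S :: "'e \<times> 'e \<Rightarrow> 'e \<times> 'e"
  assumes open_U: "open U"
    and smooth: "smooth_on (U \<times> -{0}) S"
    and JS: "\<And>z. z \<in> U \<times> -{0} \<Longrightarrow> tangent_structure z (S z) = liouville z"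
    and CS: "\<And>z. z \<in> U \<times> -{0} \<Longrightarrow> bracket liouville S z = S z"
begin

abbreviation (input) W where "W \<equiv> U \<times> -{0::'e}"

lemma open_W: "open W"
  using open_U by (intro open_Times) auto

lemma smooth_accel: "smooth_on W (accel S)"
  unfolding accel_def by (rule smooth_on_bounded_linear[OF open_W bounded_linear_snd smooth])

lemma S_eq: "z \<in> W \<Longrightarrow> S z = (snd z, accel S z)"
  using JS[of z] by (simp add: tangent_structure_def liouville_def accel_def prod_eq_iff)

lemma has_derivative_S:
  assumes "z \<in> W" shows "(S has_derivative (\<lambda>w. (snd w, dd (accel S) z w))) (at z)"
proof -
  have "((\<lambda>z. (snd z, accel S z)) has_derivative (\<lambda>w. (snd w, dd (accel S) z w))) (at z)"
    by (intro has_derivative_Pair has_derivative_snd has_derivative_ident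
        smooth_on_has_derivative[OF smooth_accel assms])
  then show ?thesis
    using has_derivative_cong_open[OF open_W assms S_eq] by simp
qed

lemma dd_S: "z \<in> W \<Longrightarrow> dd S z w = (snd w, dd (accel S) z w)"
  by (simp add: dd_eqI[OF has_derivative_S])

lemma linear_accel: "z \<in> W \<Longrightarrow> linear (dd (accel S) z)"
  by (rule dd_linear[OF smooth_accel])

lemma linear_nonlin: assumes "z \<in> W" shows "linear (nonlin S z)"
proof -
  interpret linear "dd (accel S) z" by (rule linear_accel[OF assms])
  have p: "(0::'e, a + b) = (0, a) + (0, b)" "(0::'e, r *\<^sub>R a) = r *\<^sub>R (0, a)" for a b :: 'e and r
    by auto
  show ?thesis unfolding nonlin_def
    by (rule linearI) (simp_all add: p add scale algebra_simps del: add_Pair scaleR_Pair)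
qed

lemma linear_curv: assumes z: "z \<in> W" shows "linear (curv S z)"
proof -
  interpret d: linear "dd (accel S) z" by (rule linear_accel[OF z])
  interpret N: linear "nonlin S z" by (rule linear_nonlin[OF z])
  interpret h: linear "dd2 (accel S) z (S z)" by (rule linear_dd2_right[OF open_W smooth_accel z])
  have p: "(a + b, 0::'e) = (a, 0) + (b, 0)" "(0::'e, a + b) = (0, a) + (0, b)"
    "(r *\<^sub>R a, 0::'e) = r *\<^sub>R (a, 0)" "(0::'e, r *\<^sub>R a) = r *\<^sub>R (0, a)" for a b :: 'e and r
    by auto
  show ?thesis unfolding curv_def
    by (rule linearI) (simp_all add: p d.add d.scale N.add N.scale h.add h.scale algebra_simps
       del: add_Pair scaleR_Pair)
qed

lemma has_derivative_nonlin:
  assumes z: "z \<in> W"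
  shows "((\<lambda>x. nonlin S x a) has_derivative (\<lambda>u. (1/2) *\<^sub>R dd2 (accel S) z u (0, a))) (at z)"
  unfolding nonlin_def
  by (intro has_derivative_scaleR_right smooth_on_has_derivative[OF smooth_on_dd[OF smooth_accel] z])

text \<open>Euler's identity for the 2-homogeneous \<open>accel S\<close>, which is the vertical component of
  \<open>[\<C>, S] = S\<close>. It says that \<open>S\<close> itself is horizontal.\<close>

lemma nonlin_y:
  assumes z: "z \<in> W" shows "nonlin S z (snd z) = accel S z"
proof -
  have "((\<lambda>z::'e\<times>'e. (0::'e, snd z)) has_derivative (\<lambda>w. (0, snd w))) (at z)"
    by (intro has_derivative_Pair has_derivative_snd has_derivative_ident has_derivative_const)
  then have "dd liouville z = (\<lambda>w. (0, snd w))"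
    unfolding liouville_def by (rule dd_eqI)
  then have "bracket liouville S z = (snd z, dd (accel S) z (0, snd z) - accel S z)"
    using z S_eq[OF z] by (simp add: bracket_def dd_S liouville_def)
  with CS[OF z] S_eq[OF z] have "dd (accel S) z (0, snd z) = 2 *\<^sub>R accel S z"
    by (simp add: algebra_simps scaleR_2)
  then show ?thesis by (simp add: nonlin_def)
qed

lemma lie_deriv_tangent_structure:
  assumes z: "z \<in> W"
  shows "lie_deriv S tangent_structure z w = (- fst w, snd w - 2 *\<^sub>R nonlin S z (fst w))"
  by (simp add: lie_deriv_def bracket_def tangent_structure_def dd_S[OF z] nonlin_def)

lemma horizontal_proj_eq:
  assumes z: "z \<in> W" shows "horizontal_proj S z w = (fst w, nonlin S z (fst w))"
  by (simp add: horizontal_proj_def lie_deriv_tangent_structure[OF z] prod_eq_iff scaleR_2[symmetric])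

lemma vertical_proj_eq:
  assumes z: "z \<in> W" shows "vertical_proj S z w = (0, snd w - nonlin S z (fst w))"
  by (simp add: vertical_proj_def lie_deriv_tangent_structure[OF z] prod_eq_iff algebra_simps scaleR_2[symmetric])

text \<open>The projector \<open>h\<close> depends on the base point through \<open>nonlin\<close> only, so \<open>\<L>\<^sub>S h\<close> involves \<open>S(nonlin)\<close> and the
  first derivatives of \<open>S\<close>. Projecting to the vertical part removes the dependence on the
  \<open>y\<close>-component of \<open>w\<close>.\<close>

lemma jacobi_endo_eq:
  assumes z: "z \<in> W" shows "jacobi_endo S z w = (0, curv S z (fst w))"
proof -
  interpret d: linear "dd (accel S) z" by (rule linear_accel[OF z])
  interpret N: linear "nonlin S z" by (rule linear_nonlin[OF z])
  have "((\<lambda>x. (fst w, nonlin S x (fst w))) has_derivative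
      (\<lambda>u. (0, (1/2) *\<^sub>R dd2 (accel S) z u (0, fst w)))) (at z)"
    by (intro has_derivative_Pair has_derivative_const has_derivative_nonlin z)
  then have "((\<lambda>x. horizontal_proj S x w) has_derivative
      (\<lambda>u. (0, (1/2) *\<^sub>R dd2 (accel S) z u (0, fst w)))) (at z)"
    using has_derivative_cong_open[OF open_W z, of "\<lambda>x. horizontal_proj S x w" "\<lambda>x. (fst w, nonlin S x (fst w))"]
      horizontal_proj_eq by simp
  note dh = dd_eqI[OF this]
  let ?N = "nonlin S z"
  \<comment> \<open>the value at a horizontal vector splits into its \<open>x\<close>-part and the part along the fibre\<close>
  have split: "dd (accel S) z (fst w, ?N (fst w)) = dd (accel S) z (fst w, 0) + 2 *\<^sub>R ?N (?N (fst w))"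
    using d.add[of "(fst w, 0)" "(0, ?N (fst w))"] by (simp add: nonlin_def)
  have lie: "lie_deriv S (horizontal_proj S) z w =
     (snd w - ?N (fst w),
      (1/2) *\<^sub>R dd2 (accel S) z (S z) (0, fst w) - dd (accel S) z (fst w, 0) - 2 *\<^sub>R ?N (?N (fst w)) + ?N (snd w))"
    unfolding lie_deriv_def bracket_def dh
    by (simp add: horizontal_proj_eq[OF z] dd_S[OF z] split N.neg)
  show ?thesis
    unfolding jacobi_endo_def vertical_proj_eq[OF z] lie curv_def
    by (simp add: N.diff scaleR_2)
qed

lemma ricci_eq:
  assumes z: "z \<in> W"
  shows "semibasic_trace (jacobi_endo S) z = (\<Sum>b\<in>Basis. curv S z b \<bullet> b)"
  unfolding semibasic_trace_def jacobi_endo_eq[OF z] by simp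

lemma smooth_nonlin_along:
  assumes "smooth_on W V" shows "smooth_on W (\<lambda>z. nonlin S z (V z))"
proof -
  have "bounded_linear (\<lambda>b. (0::'e, b::'e))"
    by (intro bounded_linear_Pair bounded_linear_zero bounded_linear_ident)
  then show ?thesis unfolding nonlin_def
    by (intro smooth_on_bounded_linear[OF open_W bounded_linear_scaleR_right]
        smooth_on_dd_along[OF open_W smooth_accel] smooth_on_bounded_linear[OF open_W _ assms])
qed

lemma smooth_curv: "smooth_on W (\<lambda>z. curv S z w)"
  unfolding curv_def
  by (intro smooth_on_diff[OF open_W] smooth_on_bounded_linear[OF open_W bounded_linear_scaleR_right]
        smooth_on_dd_along[OF open_W smooth_on_dd[OF smooth_accel] smooth]
        smooth_on_dd smooth_accel smooth_nonlin_along smooth_on_const)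

lemma smooth_ricci: "smooth_on W (semibasic_trace (jacobi_endo S))"
proof -
  have "smooth_on W (\<lambda>z. \<Sum>b\<in>Basis. curv S z b \<bullet> b)"
    by (intro smooth_on_sum[OF open_W] smooth_on_bounded_linear[OF open_W bounded_linear_inner_left] smooth_curv)
  then show ?thesis
    using smooth_on_cong[OF open_W ricci_eq] by simp
qed

end

section \<open>Metrizability and horizontal constancy\<close>

lemma d1_dJ:
  "d1 (dL tangent_structure E) z u w = dd2 E z u (0, fst w) - dd2 E z w (0, fst u)"
  by (simp add: d1_def dL_def d0_def tangent_structure_def)

context local_spray
begin

lemma has_derivative_euler_field:
  "((\<lambda>z::'e\<times>'e. (0::'e, snd z)) has_derivative (\<lambda>w. (0, snd w))) (at z)"
  by (intro has_derivative_Pair has_derivative_snd has_derivative_ident has_derivative_const)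

text \<open>This is \<open>i\<^sub>S d d\<^sub>J E + dE = d\<^sub>J (S E) - 2 d\<^sub>h E\<close>. On the left, the second derivatives along \<open>y\<close> are
  removed by the derivative of Euler's identity; on the right, those along \<open>S\<close> arise from differentiating
  \<open>S E\<close>. What remains are first derivatives, which combine to \<open>d\<^sub>h E\<close> because the vertical derivative of
  \<open>accel S\<close> is twice \<open>nonlin\<close>.\<close>

lemma cartan_identity:
  fixes E :: "'e \<times> 'e \<Rightarrow> real"
  assumes E: "smooth_on W E" and euler: "\<And>z. z \<in> W \<Longrightarrow> dd E z (0, snd z) = 2 * E z" and z: "z \<in> W"
  shows "d1 (dL tangent_structure E) z (S z) w + d0 E z w =
    dd (\<lambda>x. dd E x (S x)) z (0, fst w) - 2 * dL (horizontal_proj S) E z w"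
proof -
  interpret dE: linear "dd E z" by (rule dd_linear[OF E z])
  have "((\<lambda>x. dd E x (0, snd x)) has_derivative (\<lambda>u. dd2 E z u (0, snd z) + dd E z (0, snd u))) (at z)"
    by (rule has_derivative_dd_along[OF open_W E z has_derivative_ident has_derivative_euler_field])
  \<comment> \<open>both sides of Euler's identity are differentiated\<close>
  then have "((\<lambda>x. 2 * E x) has_derivative (\<lambda>u. dd2 E z u (0, snd z) + dd E z (0, snd u))) (at z)"
    by (rule has_derivative_transform_within_open[OF _ open_W z euler])
  moreover have "((\<lambda>x. 2 * E x) has_derivative (\<lambda>u. 2 * dd E z u)) (at z)"
    by (intro has_derivative_mult_right smooth_on_has_derivative[OF E z])
  ultimately have "(\<lambda>u. dd2 E z u (0, snd z) + dd E z (0, snd u)) = (\<lambda>u. 2 * dd E z u)"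
    by (rule has_derivative_unique)
  from fun_cong[OF this, of w]
  have e1: "dd2 E z w (0, snd z) + dd E z (0, snd w) = 2 * dd E z w" .
  have "((\<lambda>x. dd E x (S x)) has_derivative
      (\<lambda>u. dd2 E z u (S z) + dd E z (snd u, dd (accel S) z u))) (at z)"
    by (rule has_derivative_dd_along[OF open_W E z has_derivative_ident has_derivative_S[OF z]])
  from dd_eqI[OF this] have dP: "dd (\<lambda>x. dd E x (S x)) z (0, fst w) =
     dd2 E z (S z) (0, fst w) + dd E z (fst w, 2 *\<^sub>R nonlin S z (fst w))"
    using dd_swap[OF open_W E z, of "(0, fst w)" "S z"] by (simp add: nonlin_def)
  have h: "dd E z (fst w, 2 *\<^sub>R nonlin S z (fst w)) + dd E z (fst w, 0) =
      2 * dL (horizontal_proj S) E z w"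
    using dE.add[of "(fst w, 2 *\<^sub>R nonlin S z (fst w))" "(fst w, 0)"]
      dE.scale[of 2 "(fst w, nonlin S z (fst w))"]
    by (simp add: dL_def d0_def horizontal_proj_eq[OF z] scaleR_2)
  have "dd E z w = dd E z (fst w, 0) + dd E z (0, snd w)"
    using dE.add[of "(fst w, 0)" "(0, snd w)"] by simp
  with e1 dP h show ?thesis
    unfolding d1_dJ by (simp add: d0_def S_eq[OF z])
qed

text \<open>In both directions \<open>S E\<close> vanishes: inserting \<open>S\<close> into \<open>i\<^sub>S d d\<^sub>J E = -dE\<close> gives \<open>0 = -S E\<close> since a 2-form
  is alternating, and \<open>d\<^sub>h E (S) = S E\<close> since \<open>S\<close> is horizontal. The identity above then reads
  \<open>i\<^sub>S d d\<^sub>J E + dE = -2 d\<^sub>h E\<close>.\<close>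

theorem metrizable_iff_horizontal:
  fixes E :: "'e \<times> 'e \<Rightarrow> real"
  assumes E: "smooth_on W E" and euler: "\<And>z. z \<in> W \<Longrightarrow> dd E z (0, snd z) = 2 * E z"
  shows "(\<forall>z\<in>W. \<forall>w. d1 (dL tangent_structure E) z (S z) w = - d0 E z w) \<longleftrightarrow>
     (\<forall>z\<in>W. \<forall>w. dL (horizontal_proj S) E z w = 0)" (is "?L \<longleftrightarrow> ?R")
proof -
  have P0: "dd (\<lambda>x. dd E x (S x)) z w = 0" if "\<And>x. x \<in> W \<Longrightarrow> dd E x (S x) = 0" "z \<in> W" for z w
    using dd_cong_open[OF open_W that(2,1)] by simp
  show ?thesis
  proof
    assume ?L
    have "dd E z (S z) = 0" if "z \<in> W" for z
      using \<open>?L\<close>[rule_format, OF that, of "S z"] by (simp add: d1_dJ d0_def)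
    from cartan_identity[OF E euler] P0[OF this] \<open>?L\<close> show ?R by simp
  next
    assume ?R
    have "dd E z (S z) = 0" if "z \<in> W" for z
      using \<open>?R\<close>[rule_format, OF that, of "S z"] nonlin_y[OF that] S_eq[OF that]
      by (simp add: dL_def d0_def horizontal_proj_eq[OF that])
    then have "d1 (dL tangent_structure E) z (S z) w + d0 E z w = 0" if "z \<in> W" for z w
      using cartan_identity[OF E euler that] P0[OF _ that] \<open>?R\<close> that by simp
    then show ?L by (simp add: eq_neg_iff_add_eq_0)
  qed
qed

end

section \<open>Nondegeneracy\<close>

text \<open>A linear endomorphism is surjective if and only if its kernel is trivial, and the kernel
  of \<open>u \<mapsto> \<omega>(u, \<cdot>)\<close> is read off without coordinates.\<close>

lemma form_rank_full_iff:
  fixes \<omega> :: "'w::euclidean_space \<Rightarrow> 'w \<Rightarrow> 'w \<Rightarrow> real"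
  assumes l: "\<And>w. linear (\<lambda>u. \<omega> z u w)" and r: "\<And>u. linear (\<lambda>w. \<omega> z u w)"
  shows "form_rank \<omega> z = DIM('w) \<longleftrightarrow> (\<forall>u. (\<forall>w. \<omega> z u w = 0) \<longrightarrow> u = 0)"
proof -
  define L where "L = (\<lambda>u. \<Sum>b\<in>Basis. \<omega> z u b *\<^sub>R b)"
  have L: "linear L" unfolding L_def
    by (intro linear_compose_sum ballI)
      (rule linearI; simp add: linear_add[OF l] linear_scale[OF l] scaleR_left_distrib)
  have L0: "L u = 0 \<longleftrightarrow> (\<forall>w. \<omega> z u w = 0)" for u
  proof -
    have w: "\<omega> z u w = (\<Sum>b\<in>Basis. (w \<bullet> b) * \<omega> z u b)" for w
    proof -
      have "\<omega> z u (\<Sum>b\<in>Basis. (w \<bullet> b) *\<^sub>R b) = (\<Sum>b\<in>Basis. (w \<bullet> b) * \<omega> z u b)"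
        by (simp add: linear_sum[OF r] linear_scale[OF r])
      then show ?thesis by (simp add: euclidean_representation)
    qed
    have "L u = 0 \<longleftrightarrow> (\<forall>b\<in>Basis. \<omega> z u b = 0)"
      unfolding L_def euclidean_eq_iff[of "sum _ _"] by simp
    also have "\<dots> \<longleftrightarrow> (\<forall>w. \<omega> z u w = 0)" using w by (metis (no_types, lifting) mult_zero_right sum.neutral)
    finally show ?thesis .
  qed
  have "form_rank \<omega> z = DIM('w) \<longleftrightarrow> span (range L) = UNIV"
    unfolding form_rank_def L_def by (rule dim_eq_full)
  also have "\<dots> \<longleftrightarrow> surj L"
    using iffD2[OF span_eq_iff linear_subspace_image[OF L subspace_UNIV]] by (simp only:)
  also have "\<dots> \<longleftrightarrow> inj L"
    using L linear_injective_imp_surjective linear_surjective_imp_injective by blast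
  also have "\<dots> \<longleftrightarrow> (\<forall>u. L u = 0 \<longrightarrow> u = 0)"
    by (rule linear_inj_iff_eq_0[OF L])
  finally show ?thesis by (simp add: L0)
qed

text \<open>Since \<open>d d\<^sub>J E\<close> vanishes on pairs of vertical vectors, testing a kernel vector \<open>u\<close> against vertical vectors
  puts its \<open>x\<close>-component in the kernel of the vertical Hessian. Once \<open>u\<close> is thus known to be vertical, the other
  vectors do the same for its \<open>y\<close>-component. Conversely, \<open>(0, a)\<close> lies in the kernel of \<open>d d\<^sub>J E\<close> for every
  \<open>a\<close> in the kernel of the Hessian.\<close>

lemma form_rank_ddJ_full_iff:
  fixes E :: "'e::euclidean_space \<times> 'e \<Rightarrow> real"
  assumes W: "open W" and E: "smooth_on W E" and z: "z \<in> W"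
  shows "form_rank (d1 (dL tangent_structure E)) z = 2 * DIM('e) \<longleftrightarrow>
    (\<forall>a. (\<forall>b. dd2 E z (0, a) (0, b) = 0) \<longrightarrow> a = 0)"
proof -
  have l: "linear (\<lambda>u. dd2 E z u w)" for w by (rule dd_linear[OF smooth_on_dd[OF E] z])
  have r: "linear (\<lambda>w. dd2 E z u w)" for u by (rule linear_dd2_right[OF W E z])
  have i: "linear (\<lambda>w::'e\<times>'e. (0::'e, fst w))"
    by (rule linearI) auto
  have lin1: "linear (\<lambda>u. d1 (dL tangent_structure E) z u w)" for w
    unfolding d1_dJ using linear_compose[OF i r[of w]]
    by (intro linear_compose_sub l) (simp add: o_def)
  have lin2: "linear (\<lambda>w. d1 (dL tangent_structure E) z u w)" for u
    unfolding d1_dJ using linear_compose[OF i r[of u]]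
    by (intro linear_compose_sub l) (simp add: o_def)
  have D0: "dd2 E z (0, 0) w = 0" "dd2 E z w (0, 0) = 0" for w
    using linear_0[OF l[of w]] linear_0[OF r[of w]] by (simp_all add: zero_prod_def)
  have "(\<forall>u. (\<forall>w. d1 (dL tangent_structure E) z u w = 0) \<longrightarrow> u = 0) \<longleftrightarrow>
    (\<forall>a. (\<forall>b. dd2 E z (0, a) (0, b) = 0) \<longrightarrow> a = 0)" (is "?L \<longleftrightarrow> ?R")
  proof
    assume L: ?L
    show ?R
    proof (intro allI impI)
      fix a assume "\<forall>b. dd2 E z (0, a) (0, b) = 0"
      then have "\<forall>w. d1 (dL tangent_structure E) z (0, a) w = 0"
        by (simp add: d1_dJ D0)
      with L have "(0, a) = (0 :: 'e \<times> 'e)" by blast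
      then show "a = 0" by (simp add: zero_prod_def)
    qed
  next
    assume R: ?R
    show ?L
    proof (intro allI impI)
      fix u assume u: "\<forall>w. d1 (dL tangent_structure E) z u w = 0"
      have "dd2 E z (0, fst u) (0, b) = 0" for b
        using u[rule_format, of "(0, b)"] dd_swap[OF W E z, of "(0, b)" "(0, fst u)"]
        by (simp add: d1_dJ D0)
      with R have 1: "fst u = 0" by blast
      have "dd2 E z (0, snd u) (0, b) = 0" for b
        using u[rule_format, of "(b, 0)"] 1 by (cases u) (simp add: d1_dJ D0)
      with R have "snd u = 0" by blast
      with 1 show "u = 0" by (simp add: prod_eq_iff)
    qed
  qed
  moreover have "2 * DIM('e) = DIM('e \<times> 'e)" by simp
  ultimately show ?thesis using form_rank_full_iff[of "d1 (dL tangent_structure E)" z, OF lin1 lin2] by metis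
qed

text \<open>The right-hand side is the same as in the preceding criterion for \<open>d d\<^sub>J E\<close>; this is how the two
  rank conditions are compared.\<close>

lemma rank_fundamental_tensor_full_iff:
  fixes F E :: "(real^'n) \<times> (real^'n) \<Rightarrow> real"
  assumes W: "open W" and E: "smooth_on W E" and z: "z \<in> W" and FE: "\<And>x. x \<in> W \<Longrightarrow> (F x)\<^sup>2 = E x"
  shows "rank (fundamental_tensor F z) = CARD('n) \<longleftrightarrow>
    (\<forall>a. (\<forall>b. dd2 E z (0, a) (0, b) = 0) \<longrightarrow> a = 0)"
proof -
  have l: "linear (\<lambda>u. dd2 E z u w)" for w by (rule dd_linear[OF smooth_on_dd[OF E] z])
  have r: "linear (\<lambda>w. dd2 E z u w)" for u by (rule linear_dd2_right[OF W E z])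
  have "dd2 (\<lambda>x. (F x)\<^sup>2) z u w = dd2 E z u w" for u w
    by (subst dd_cong_open[OF W z, of "\<lambda>x. dd (\<lambda>x'. (F x')\<^sup>2) x w" "\<lambda>x. dd E x w"])
      (use dd_cong_open[OF W _ FE] in auto)
  then have g: "fundamental_tensor F z $ i $ j = (1/2) * dd2 E z (0, axis i 1) (0, axis j 1)" for i j
    by (simp add: fundamental_tensor_def)
  have expand: "f (0, a) = (\<Sum>j\<in>UNIV. (a $ j) * f (0, axis j 1))"
    if "linear f" for f :: "(real^'n) \<times> (real^'n) \<Rightarrow> real" and a
  proof -
    have i: "linear (\<lambda>b::real^'n. (0::real^'n, b))" by (rule linearI) auto
    have "f (0, a) = (f \<circ> (\<lambda>b. (0, b))) (\<Sum>j\<in>UNIV. (a $ j) *\<^sub>R axis j 1)"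
      using basis_expansion[of a] by (simp add: scalar_mult_eq_scaleR)
    also have "\<dots> = (\<Sum>j\<in>UNIV. (a $ j) * f (0, axis j 1))"
      using linear_compose[OF i that] by (simp only: linear_sum linear_scale) simp
    finally show ?thesis .
  qed
  have mult: "(fundamental_tensor F z *v a) $ i = (1/2) * dd2 E z (0, axis i 1) (0, a)" for a i
    unfolding matrix_vector_mult_def using expand[OF r[of "(0, axis i 1)"], where a=a]
    by (simp add: g sum_distrib_left mult_ac)
  have "rank (fundamental_tensor F z) = CARD('n) \<longleftrightarrow> (\<forall>a. fundamental_tensor F z *v a = 0 \<longrightarrow> a = 0)"
    unfolding full_rank_injective by (simp add: linear_inj_iff_eq_0)
  also have "\<dots> \<longleftrightarrow> (\<forall>a. (\<forall>i. dd2 E z (0, axis i 1) (0, a) = 0) \<longrightarrow> a = 0)"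
    by (simp add: vec_eq_iff mult)
  also have "\<dots> \<longleftrightarrow> (\<forall>a. (\<forall>b. dd2 E z (0, b) (0, a) = 0) \<longrightarrow> a = 0)"
  proof -
    have "(\<forall>i. dd2 E z (0, axis i 1) (0, a) = 0) \<longleftrightarrow> (\<forall>b. dd2 E z (0, b) (0, a) = 0)" for a
    proof (intro iffI allI)
      fix b assume "\<forall>i. dd2 E z (0, axis i 1) (0, a) = 0"
      then show "dd2 E z (0, b) (0, a) = 0"
        by (subst expand[OF l[of "(0, a)"]]) simp
    qed simp
    then show ?thesis by simp
  qed
  finally show ?thesis using dd_swap[OF W E z] by metis
qed

section \<open>Homogeneity\<close>

text \<open>Along a ray, Euler's identity says that \<open>T(x, t y) / t\<^sup>2\<close> has derivative \<open>0\<close> for \<open>t > 0\<close>.\<close>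

lemma euler_imp_homogeneous:
  fixes T :: "'e::euclidean_space \<times> 'e \<Rightarrow> real"
  assumes T: "smooth_on (U \<times> -{0}) T"
    and euler: "\<And>z. z \<in> U \<times> -{0} \<Longrightarrow> dd T z (0, snd z) = 2 * T z"
    and x: "x \<in> U" and y: "y \<noteq> 0" and t: "t > 0"
  shows "T (x, t *\<^sub>R y) = t\<^sup>2 * T (x, y)"
proof -
  let ?g = "\<lambda>t. T (x, t *\<^sub>R y) / t\<^sup>2"
  have "(?g has_derivative (\<lambda>h. 0)) (at t within {0<..})" if t: "t \<in> {0<..}" for t :: real
  proof -
    have z: "(x, t *\<^sub>R y) \<in> U \<times> -{0}" using x y t by simp
    interpret linear "dd T (x, t *\<^sub>R y)" by (rule dd_linear[OF T z])
    have "dd T (x, t *\<^sub>R y) (0, y) = 2 * T (x, t *\<^sub>R y) / t"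
      using euler[OF z] scale[of t "(0, y)"] t by (simp add: field_simps)
    define c where "c = 2 * T (x, t *\<^sub>R y) / t"
    have d: "dd T (x, t *\<^sub>R y) (0, h *\<^sub>R y) = c * h" for h
      using \<open>dd T _ _ = _\<close> scale[of h "(0, y)"] by (simp add: c_def)
    have "((\<lambda>t. (x, t *\<^sub>R y)) has_derivative (\<lambda>h. (0, h *\<^sub>R y))) (at t)"
      by (auto intro!: derivative_eq_intros)
    from has_derivative_compose[OF this smooth_on_has_derivative[OF T z]]
    have "((\<lambda>t. T (x, t *\<^sub>R y)) has_real_derivative c) (at t)"
      by (simp add: d has_field_derivative_def)
    then have "(?g has_real_derivative (c * t\<^sup>2 - T (x, t *\<^sub>R y) * (2 * t)) / (t\<^sup>2 * t\<^sup>2)) (at t)"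
      using t by (auto intro!: derivative_eq_intros)
    moreover have "(c * t\<^sup>2 - T (x, t *\<^sub>R y) * (2 * t)) / (t\<^sup>2 * t\<^sup>2) = 0"
      using t by (simp add: c_def power2_eq_square)
    ultimately have "(?g has_real_derivative 0) (at t)" by (simp only:)
    moreover have "(*) (0::real) = (\<lambda>h. 0)" by auto
    ultimately show ?thesis
      unfolding has_field_derivative_def by (metis has_derivative_at_withinI)
  qed
  then obtain c where c: "\<And>t. t \<in> {0<..} \<Longrightarrow> ?g t = c"
    using has_derivative_zero_constant[of "{0::real<..}" ?g] by auto
  have "?g t = ?g 1" using c[of t] c[of 1] t by auto
  then show ?thesis using t by (simp add: field_simps)
qed

lemma homogeneous_imp_euler:
  fixes F :: "'e::euclidean_space \<times> 'e \<Rightarrow> real"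
  assumes F: "smooth_on W F" and z: "(x, y) \<in> W"
    and hom: "\<And>t. t > 0 \<Longrightarrow> F (x, t *\<^sub>R y) = t * F (x, y)"
  shows "dd F (x, y) (0, y) = F (x, y)"
proof -
  interpret linear "dd F (x, y)" by (rule dd_linear[OF F z])
  have "((\<lambda>t. (x, t *\<^sub>R y)) has_derivative (\<lambda>h. (0, h *\<^sub>R y))) (at 1)"
    by (auto intro!: derivative_eq_intros)
  from has_derivative_compose[OF this, of F] smooth_on_has_derivative[OF F z]
  have "((\<lambda>t. F (x, t *\<^sub>R y)) has_derivative (\<lambda>h. dd F (x, y) (0, h *\<^sub>R y))) (at 1)"
    by simp
  then have "((\<lambda>t. t * F (x, y)) has_derivative (\<lambda>h. dd F (x, y) (0, h *\<^sub>R y))) (at 1)"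
    by (rule has_derivative_transform_within_open[of _ _ _ _ "{0<..}"]) (use hom in auto)
  moreover have "((\<lambda>t. t * F (x, y)) has_derivative (\<lambda>h. h * F (x, y))) (at 1)"
    by (auto intro!: derivative_eq_intros)
  ultimately have "(\<lambda>h. dd F (x, y) (0, h *\<^sub>R y)) = (\<lambda>h. h * F (x, y))"
    by (rule has_derivative_unique)
  from fun_cong[OF this, of 1] show ?thesis by simp
qed

section \<open>Change of chart\<close>

lemma basis_trace_commute:
  fixes A B :: "'e::euclidean_space \<Rightarrow> 'e"
  assumes A: "linear A" and B: "linear B"
  shows "(\<Sum>b\<in>Basis. A (B b) \<bullet> b) = (\<Sum>b\<in>Basis. B (A b) \<bullet> b)"
proof -
  \<comment> \<open>both traces are the same double sum of products of matrix entries\<close>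
  have *: "A' (B' b) \<bullet> b = (\<Sum>c\<in>Basis. (B' b \<bullet> c) * (A' c \<bullet> b))" if A': "linear A'" for A' B' :: "'e \<Rightarrow> 'e" and b
  proof -
    have "A' (\<Sum>c\<in>Basis. (B' b \<bullet> c) *\<^sub>R c) \<bullet> b = (\<Sum>c\<in>Basis. (B' b \<bullet> c) * (A' c \<bullet> b))"
      by (simp add: linear_sum[OF A'] linear_scale[OF A'] inner_sum_left)
    then show ?thesis by (simp add: euclidean_representation)
  qed
  have "(\<Sum>b\<in>Basis. A (B b) \<bullet> b) = (\<Sum>b\<in>Basis. \<Sum>c\<in>Basis. (B b \<bullet> c) * (A c \<bullet> b))"
    by (simp only: *[OF A])
  also have "\<dots> = (\<Sum>c\<in>Basis. \<Sum>b\<in>Basis. (A c \<bullet> b) * (B b \<bullet> c))"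
    by (subst sum.swap) (simp add: mult.commute)
  also have "\<dots> = (\<Sum>b\<in>Basis. B (A b) \<bullet> b)"
    by (simp only: *[OF B])
  finally show ?thesis .
qed

definition tangent_map :: "('e::real_normed_vector \<Rightarrow> 'e) \<Rightarrow> 'e \<times> 'e \<Rightarrow> 'e \<times> 'e" where
  "tangent_map \<tau> z = (\<tau> (fst z), dd \<tau> (fst z) (snd z))"

lemma has_derivative_tangent_map:
  fixes \<tau> :: "'e::euclidean_space \<Rightarrow> 'e"
  assumes V: "open V" and \<tau>: "smooth_on V \<tau>" and z: "fst z \<in> V"
  shows "(tangent_map \<tau> has_derivative
    (\<lambda>u. (dd \<tau> (fst z) (fst u), dd2 \<tau> (fst z) (fst u) (snd z) + dd \<tau> (fst z) (snd u)))) (at z)"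
proof -
  have 1: "(fst has_derivative fst) (at z)" "(snd has_derivative snd) (at z)"
    by (auto intro!: derivative_eq_intros)
  show ?thesis unfolding tangent_map_def
    by (intro has_derivative_Pair has_derivative_compose[OF 1(1) smooth_on_has_derivative[OF \<tau> z]]
        has_derivative_dd_along[OF V \<tau> z 1])
qed

text \<open>In the application \<open>\<tau>\<close> is the transition map between two charts of the manifold, \<open>V\<close> is the image of
  their overlap in the first one, and \<open>tangent_map \<tau>\<close> is the induced transition map of the tangent bundle.\<close>

locale spray_transition = S: local_spray U S + S': local_spray U' S'
  for U :: "'e::euclidean_space set" and S and U' :: "'e set" and S' +
  fixes V :: "'e set" and \<tau> :: "'e \<Rightarrow> 'e"
  assumes open_V: "open V" and VU: "V \<subseteq> U" and \<tau>: "smooth_on V \<tau>"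
    and \<tau>U': "\<And>x. x \<in> V \<Longrightarrow> \<tau> x \<in> U'"
    and inj: "\<And>x w. x \<in> V \<Longrightarrow> w \<noteq> 0 \<Longrightarrow> dd \<tau> x w \<noteq> 0"
    and related: "\<And>z. z \<in> V \<times> -{0} \<Longrightarrow> S' (tangent_map \<tau> z) = dd (tangent_map \<tau>) z (S z)"
begin

lemma open_VW: "open (V \<times> -{0::'e})"
  using open_V by (intro open_Times) auto

lemma in_W: "z \<in> V \<times> -{0} \<Longrightarrow> z \<in> U \<times> -{0}"
  and in_W': "z \<in> V \<times> -{0} \<Longrightarrow> tangent_map \<tau> z \<in> U' \<times> -{0}"
  using VU \<tau>U' inj by (auto simp: tangent_map_def)

lemma dd_tangent_map:
  "z \<in> V \<times> -{0} \<Longrightarrow> dd (tangent_map \<tau>) z u =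
    (dd \<tau> (fst z) (fst u), dd2 \<tau> (fst z) (fst u) (snd z) + dd \<tau> (fst z) (snd u))"
  by (subst dd_eqI[OF has_derivative_tangent_map[OF open_V \<tau>]]) auto

lemma accel_transition:
  assumes z: "z \<in> V \<times> -{0}"
  shows "accel S' (tangent_map \<tau> z) = dd2 \<tau> (fst z) (snd z) (snd z) + dd \<tau> (fst z) (accel S z)"
proof -
  have "accel S' (tangent_map \<tau> z) = snd (dd (tangent_map \<tau>) z (S z))"
    by (simp only: accel_def[of S'] related[OF z])
  then show ?thesis by (simp add: dd_tangent_map[OF z] S.S_eq[OF in_W[OF z]])
qed

text \<open>Only the second component of \<open>S\<close> transforms in an interesting way, with an inhomogeneous
  term \<open>\<tau>''(y, y)\<close>. Its derivatives in horizontal and vertical coordinate directions are the transformation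
  laws from which those of the connection and of the curvature are assembled.\<close>

lemma dd_accel_transition:
  assumes z: "z \<in> V \<times> -{0}"
  shows "dd (accel S') (tangent_map \<tau> z) (dd (tangent_map \<tau>) z u) =
    dd3 \<tau> (fst z) (fst u) (snd z) (snd z) + 2 *\<^sub>R dd2 \<tau> (fst z) (snd u) (snd z)
    + dd2 \<tau> (fst z) (fst u) (accel S z) + dd \<tau> (fst z) (dd (accel S) z u)"
proof -
  have x: "fst z \<in> V" using z by auto
  have 1: "(fst has_derivative fst) (at z)" "(snd has_derivative snd) (at z)"
    by (auto intro!: derivative_eq_intros)
  have "((\<lambda>z. dd2 \<tau> (fst z) (snd z) (snd z) + dd \<tau> (fst z) (accel S z)) has_derivative
    (\<lambda>u. (dd3 \<tau> (fst z) (fst u) (snd z) (snd z) + dd2 \<tau> (fst z) (snd u) (snd z) + dd2 \<tau> (fst z) (snd z) (snd u))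
      + (dd2 \<tau> (fst z) (fst u) (accel S z) + dd \<tau> (fst z) (dd (accel S) z u)))) (at z)"
    by (intro has_derivative_add has_derivative_dd2_along[OF open_V \<tau> x 1(1) 1(2) 1(2)]
        has_derivative_dd_along[OF open_V \<tau> x 1(1) smooth_on_has_derivative[OF S.smooth_accel in_W[OF z]]])
  then have A: "((\<lambda>z. accel S' (tangent_map \<tau> z)) has_derivative
    (\<lambda>u. (dd3 \<tau> (fst z) (fst u) (snd z) (snd z) + dd2 \<tau> (fst z) (snd u) (snd z) + dd2 \<tau> (fst z) (snd z) (snd u))
      + (dd2 \<tau> (fst z) (fst u) (accel S z) + dd \<tau> (fst z) (dd (accel S) z u)))) (at z)"
    by (rule has_derivative_transform_within_open[OF _ open_VW z accel_transition[symmetric]])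
  have "(tangent_map \<tau> has_derivative dd (tangent_map \<tau>) z) (at z)"
    by (rule has_derivative_dd, unfold differentiable_def, rule exI, rule has_derivative_tangent_map[OF open_V \<tau> x])
  from has_derivative_compose[OF this smooth_on_has_derivative[OF S'.smooth_accel in_W'[OF z]]]
  have B: "((\<lambda>z. accel S' (tangent_map \<tau> z)) has_derivative
    (\<lambda>u. dd (accel S') (tangent_map \<tau> z) (dd (tangent_map \<tau>) z u))) (at z)" .
  \<comment> \<open>the two derivatives of \<open>\<tau>''(y, y)\<close> in \<open>y\<close> agree by symmetry, whence the factor 2\<close>
  from fun_cong[OF has_derivative_unique[OF B A], of u] show ?thesis
    using dd_swap[OF open_V \<tau> x, of "snd u" "snd z"] by (simp add: scaleR_2 add.assoc)
qed

lemma nonlin_transition: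
  assumes z: "z \<in> V \<times> -{0}"
  shows "nonlin S' (tangent_map \<tau> z) (dd \<tau> (fst z) w) =
    dd2 \<tau> (fst z) w (snd z) + dd \<tau> (fst z) (nonlin S z w)"
proof -
  have x: "fst z \<in> V" using z by auto
  interpret d: linear "dd \<tau> (fst z)" by (rule dd_linear[OF \<tau> x])
  have 0: "dd2 \<tau> (fst z) 0 v = 0" "dd3 \<tau> (fst z) 0 v v' = 0" for v v'
    using linear_0[OF dd_linear[OF smooth_on_dd[OF \<tau>] x]]
      linear_0[OF dd_linear[OF smooth_on_dd[OF smooth_on_dd[OF \<tau>]] x]] by auto
  show ?thesis
    using dd_accel_transition[OF z, of "(0, w)"]
    by (simp add: nonlin_def dd_tangent_map[OF z] 0 d.zero d.scale scaleR_add_right)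
qed

text \<open>\<open>R\<close> is a tensor. The derivative of the law for \<open>nonlin\<close> along \<open>S\<close>, the derivative of the law for \<open>accel\<close> along
  \<open>x\<close>, and the law for \<open>nonlin\<close> applied twice give the three terms of \<open>R\<close>, each with inhomogeneous terms
  containing \<open>\<tau>''\<close> and \<open>\<tau>'''\<close>. These cancel, the third derivatives \<open>\<tau>'''(y, w, y)\<close> and \<open>\<tau>'''(w, y, y)\<close> by
  symmetry.\<close>

lemma curv_transition:
  assumes z: "z \<in> V \<times> -{0}"
  shows "curv S' (tangent_map \<tau> z) (dd \<tau> (fst z) w) = dd \<tau> (fst z) (curv S z w)"
proof -
  have x: "fst z \<in> V" using z by auto
  let ?z = "tangent_map \<tau> z" and ?x = "fst z" and ?y = "snd z"
  let ?q = "dd2 \<tau> ?x w ?y"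
  interpret d: linear "dd \<tau> ?x" by (rule dd_linear[OF \<tau> x])
  interpret d': linear "dd (accel S') ?z" by (rule S'.linear_accel[OF in_W'[OF z]])
  interpret N': linear "nonlin S' ?z" by (rule S'.linear_nonlin[OF in_W'[OF z]])
  have 1: "(fst has_derivative fst) (at z)" "(snd has_derivative snd) (at z)"
    by (auto intro!: derivative_eq_intros)
  have \<Psi>: "(tangent_map \<tau> has_derivative dd (tangent_map \<tau>) z) (at z)"
    by (rule has_derivative_dd, unfold differentiable_def, rule exI, rule has_derivative_tangent_map[OF open_V \<tau> x])
  have swap: "dd2 \<tau> ?x a b = dd2 \<tau> ?x b a" for a b by (rule dd_swap[OF open_V \<tau> x])
  have R: "((\<lambda>z. dd2 \<tau> (fst z) w (snd z) + dd \<tau> (fst z) (nonlin S z w)) has_derivative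
      (\<lambda>u. (dd3 \<tau> ?x (fst u) w ?y + dd2 \<tau> ?x 0 ?y + dd2 \<tau> ?x w (snd u))
        + (dd2 \<tau> ?x (fst u) (nonlin S z w) + dd \<tau> ?x ((1/2) *\<^sub>R dd2 (accel S) z u (0, w))))) (at z)"
    by (intro has_derivative_add has_derivative_dd2_along[OF open_V \<tau> x 1(1) has_derivative_const 1(2)]
      has_derivative_dd_along[OF open_V \<tau> x 1(1) S.has_derivative_nonlin[OF in_W[OF z]]])
  have "((\<lambda>z. dd \<tau> (fst z) w) has_derivative (\<lambda>u. dd2 \<tau> ?x (fst u) w)) (at z)"
    using has_derivative_compose[OF 1(1) smooth_on_has_derivative[OF smooth_on_dd[OF \<tau>] x]] .
  then have "((\<lambda>z. (0, dd \<tau> (fst z) w)) has_derivative (\<lambda>u. (0::'e, dd2 \<tau> ?x (fst u) w))) (at z)"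
    by (intro has_derivative_Pair has_derivative_const)
  then have "((\<lambda>z. nonlin S' (tangent_map \<tau> z) (dd \<tau> (fst z) w)) has_derivative
      (\<lambda>u. (1/2) *\<^sub>R (dd2 (accel S') ?z (dd (tangent_map \<tau>) z u) (0, dd \<tau> ?x w)
        + dd (accel S') ?z (0, dd2 \<tau> ?x (fst u) w)))) (at z)"
    unfolding nonlin_def
    by (intro has_derivative_scaleR_right has_derivative_dd_along[OF S'.open_W S'.smooth_accel in_W'[OF z] \<Psi>])
  then have L: "((\<lambda>z. dd2 \<tau> (fst z) w (snd z) + dd \<tau> (fst z) (nonlin S z w)) has_derivative
      (\<lambda>u. (1/2) *\<^sub>R (dd2 (accel S') ?z (dd (tangent_map \<tau>) z u) (0, dd \<tau> ?x w)
        + dd (accel S') ?z (0, dd2 \<tau> ?x (fst u) w)))) (at z)"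
    by (rule has_derivative_transform_within_open[OF _ open_VW z nonlin_transition])
  have 0: "dd2 \<tau> ?x 0 ?y = 0"
    by (rule linear_0[OF dd_linear[OF smooth_on_dd[OF \<tau>] x]])
  have vertical: "dd (accel S') ?z (0, v) = 2 *\<^sub>R nonlin S' ?z v" for v
    by (simp add: nonlin_def)
  have S_comp: "fst (S z) = ?y" "snd (S z) = accel S z"
    using S.S_eq[OF in_W[OF z]] by (simp_all add: prod_eq_iff)
  \<comment> \<open>the law for \<open>nonlin\<close> differentiated along \<open>S\<close>\<close>
  have A: "(1/2) *\<^sub>R dd2 (accel S') ?z (S' ?z) (0, dd \<tau> ?x w) + nonlin S' ?z ?q =
      dd3 \<tau> ?x ?y w ?y + dd2 \<tau> ?x w (accel S z) + dd2 \<tau> ?x ?y (nonlin S z w)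
      + dd \<tau> ?x ((1/2) *\<^sub>R dd2 (accel S) z (S z) (0, w))"
    using fun_cong[OF has_derivative_unique[OF L R], of "S z"]
    by (simp add: related[OF z, symmetric] S_comp 0 scaleR_add_right vertical swap[of ?y w] add.assoc)
  \<comment> \<open>the law for \<open>accel\<close> differentiated in the direction \<open>(w, 0)\<close>\<close>
  have B: "dd (accel S') ?z (dd \<tau> ?x w, 0) + 2 *\<^sub>R nonlin S' ?z ?q =
      dd3 \<tau> ?x w ?y ?y + dd2 \<tau> ?x w (accel S z) + dd \<tau> ?x (dd (accel S) z (w, 0))"
    using dd_accel_transition[OF z, of "(w, 0)"] d'.add[of "(dd \<tau> ?x w, 0)" "(0, ?q)"]
    by (simp add: dd_tangent_map[OF z] d.zero linear_0[OF dd_linear[OF smooth_on_dd[OF \<tau>] x]] vertical)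
  \<comment> \<open>the law for \<open>nonlin\<close> applied twice\<close>
  have C: "nonlin S' ?z (nonlin S' ?z (dd \<tau> ?x w)) =
      nonlin S' ?z ?q + dd2 \<tau> ?x ?y (nonlin S z w) + dd \<tau> ?x (nonlin S z (nonlin S z w))"
    using nonlin_transition[OF z, of w] nonlin_transition[OF z, of "nonlin S z w"]
    by (simp add: N'.add swap[of ?y "nonlin S z w"])
  have D: "dd3 \<tau> ?x ?y w ?y = dd3 \<tau> ?x w ?y ?y"
    by (rule dd3_swap(1)[OF open_V \<tau> x])
  have cancel: "a - b - (q + f + k) = g - h - k"
    if "a + q = d + e + f + g" "b + 2 *\<^sub>R q = d + e + h" for a b d e f g h k q :: 'e
  proof -
    have "a = d + e + f + g - q" "b = d + e + h - 2 *\<^sub>R q"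
      using that by (simp_all add: eq_diff_eq)
    then show ?thesis by (simp add: scaleR_2)
  qed
  show ?thesis
    unfolding curv_def d.diff C by (rule cancel[OF A[unfolded D] B])
qed

text \<open>By \<open>curv_transition\<close> the two endomorphisms are conjugate, hence have the same trace.\<close>

lemma ricci_transition:
  assumes z: "z \<in> V \<times> -{0}"
  shows "semibasic_trace (jacobi_endo S') (tangent_map \<tau> z) = semibasic_trace (jacobi_endo S) z"
proof -
  have x: "fst z \<in> V" using z by auto
  let ?T = "dd \<tau> (fst z)"
  have T: "linear ?T" by (rule dd_linear[OF \<tau> x])
  have "inj ?T" using linear_inj_iff_eq_0[OF T] inj[OF x] by blast
  then obtain I where I: "linear I" "\<And>v. I (?T v) = v" "\<And>v. ?T (I v) = v"
    using linear_injective_isomorphism[OF T] by blast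
  have "(\<Sum>b\<in>Basis. curv S' (tangent_map \<tau> z) b \<bullet> b) = (\<Sum>b\<in>Basis. ?T ((curv S z \<circ> I) b) \<bullet> b)"
    using curv_transition[OF z, of "I _"] by (simp add: I)
  also have "\<dots> = (\<Sum>b\<in>Basis. (curv S z \<circ> I) (?T b) \<bullet> b)"
    by (intro basis_trace_commute T linear_compose I S.linear_curv in_W z)
  also have "\<dots> = (\<Sum>b\<in>Basis. curv S z b \<bullet> b)" by (simp add: I)
  finally show ?thesis using S'.ricci_eq[OF in_W'[OF z]] S.ricci_eq[OF in_W[OF z]] by simp
qed

end

section \<open>The equivalence in one chart\<close>

lemma sum_vertical_basis:
  fixes L :: "'e::euclidean_space \<times> 'e \<Rightarrow> real"
  assumes "linear L"
  shows "(\<Sum>b\<in>Basis. (v \<bullet> b) * L (0, b)) = L (0, v)"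
proof -
  interpret linear L by fact
  have "(\<Sum>b\<in>Basis. (v \<bullet> b) * L (0, b)) = L (\<Sum>b\<in>Basis. (v \<bullet> b) *\<^sub>R (0, b))"
    by (simp only: sum scale real_scaleR_def)
  also have "(\<Sum>b\<in>Basis. (v \<bullet> b) *\<^sub>R (0::'e, b)) = (0, v)"
  proof -
    have "(\<Sum>b\<in>Basis. (0::'e, (v \<bullet> b) *\<^sub>R b)) = (0, \<Sum>b\<in>Basis. (v \<bullet> b) *\<^sub>R b)"
      by (simp add: prod_eq_iff fst_sum snd_sum)
    then show ?thesis by (simp add: euclidean_representation)
  qed
  finally show ?thesis .
qed

text \<open>The first summand contributes \<open>n F\<^sup>2\<close> and the rank-one summand \<open>F d\<^sub>JF \<otimes> \<C>\<close> contributes \<open>F \<C>(F) = F\<^sup>2\<close>.\<close>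

lemma trace_constant_flag_curvature:
  fixes F :: "'e::euclidean_space \<times> 'e \<Rightarrow> real"
  assumes F: "smooth_on W F" and z: "z \<in> W" and hom: "dd F z (0, snd z) = F z"
    and \<Phi>: "\<And>w. \<Phi> z w = \<kappa> *\<^sub>R ((F z)\<^sup>2 *\<^sub>R tangent_structure z w
                    - (F z * dL tangent_structure F z w) *\<^sub>R liouville z)"
  shows "semibasic_trace \<Phi> z = \<kappa> * (real DIM('e) - 1) * (F z)\<^sup>2"
proof -
  have e: "(\<Sum>b\<in>Basis. (snd z \<bullet> b) * dd F z (0, b)) = F z"
    by (simp only: sum_vertical_basis[OF dd_linear[OF F z]] hom)
  have "semibasic_trace \<Phi> z = (\<Sum>b\<in>Basis. \<kappa> * (F z)\<^sup>2 - \<kappa> * F z * ((snd z \<bullet> b) * dd F z (0, b)))"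
    unfolding semibasic_trace_def
    by (rule sum.cong) (auto simp: \<Phi> tangent_structure_def liouville_def dL_def d0_def algebra_simps)
  also have "\<dots> = real DIM('e) * (\<kappa> * (F z)\<^sup>2) - \<kappa> * F z * F z"
    by (simp add: sum_subtractf e flip: sum_distrib_left)
  finally show ?thesis by (simp add: algebra_simps power2_eq_square)
qed

lemma smooth_on_power2:
  fixes f :: "'e::real_normed_vector \<Rightarrow> real"
  assumes "open W" "smooth_on W f" shows "smooth_on W (\<lambda>x. (f x)\<^sup>2)"
  unfolding power2_eq_square by (rule smooth_on_bilinear[OF assms(1) bounded_bilinear_mult assms(2,2)])

lemma dd_power2:
  fixes f :: "'e::real_normed_vector \<Rightarrow> real"
  assumes "smooth_on W f" "z \<in> W" shows "dd (\<lambda>x. (f x)\<^sup>2) z w = 2 * f z * dd f z w"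
proof -
  have "((\<lambda>x. f x * f x) has_derivative (\<lambda>w. f z * dd f z w + dd f z w * f z)) (at z)"
    by (intro has_derivative_mult smooth_on_has_derivative[OF assms])
  from dd_eqI[OF this] show ?thesis by (simp add: power2_eq_square)
qed

text \<open>Once the Ricci curvature is \<open>\<kappa> (n - 1) F\<^sup>2\<close>, regularity of \<open>F\<close>, metrizability of \<open>S\<close> by \<open>F\<close> and the formula
  for \<open>\<Phi>\<close> are each equivalent to one of the three conditions. Both directions of the main
  theorem rest on this; they differ only in how the proportionality is obtained.\<close>

theorem local_equivalence:
  fixes U :: "(real^'n) set" and S F
  defines "R \<equiv> semibasic_trace (jacobi_endo S)"
  assumes spray: "local_spray U S" and n: "CARD('n) \<ge> 2"
    and F: "smooth_on (U \<times> -{0}) F"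
    and hom: "\<And>x y t. x \<in> U \<Longrightarrow> y \<noteq> 0 \<Longrightarrow> t > 0 \<Longrightarrow> F (x, t *\<^sub>R y) = t * F (x, y)"
    and \<kappa>: "\<kappa> \<noteq> 0" and RF: "\<And>z. z \<in> U \<times> -{0} \<Longrightarrow> R z = \<kappa> * (real CARD('n) - 1) * (F z)\<^sup>2"
  shows "z \<in> U \<times> -{0} \<Longrightarrow> rank (fundamental_tensor F z) = CARD('n) \<longleftrightarrow>
       form_rank (d1 (dL tangent_structure R)) z = 2 * CARD('n)"
    and "(\<forall>z\<in>U \<times> -{0}. \<forall>w. d1 (dL tangent_structure (\<lambda>x. (F x)\<^sup>2)) z (S z) w = - d0 (\<lambda>x. (F x)\<^sup>2) z w) \<longleftrightarrow>
       (\<forall>z\<in>U \<times> -{0}. \<forall>w. dL (horizontal_proj S) R z w = 0)"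
    and "z \<in> U \<times> -{0} \<Longrightarrow> jacobi_endo S z w = \<kappa> *\<^sub>R ((F z)\<^sup>2 *\<^sub>R tangent_structure z w
                    - (F z * dL tangent_structure F z w) *\<^sub>R liouville z) \<longleftrightarrow>
       (2 * (real CARD('n) - 1)) *\<^sub>R jacobi_endo S z w - (2 * R z) *\<^sub>R tangent_structure z w
              + dL tangent_structure R z w *\<^sub>R liouville z = 0"
proof -
  interpret local_spray U S by (rule spray)
  define c where "c = \<kappa> * (real CARD('n) - 1)"
  have c: "c \<noteq> 0" using \<kappa> n by (simp add: c_def)
  let ?E = "\<lambda>x. (F x)\<^sup>2"
  have E: "smooth_on W ?E" by (rule smooth_on_power2[OF open_W F])
  have R: "smooth_on W R" unfolding R_def by (rule smooth_ricci)
  have ddR: "dd R z w = c * dd ?E z w" if "z \<in> W" for z w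
  proof -
    have "((\<lambda>x. c * ?E x) has_derivative (\<lambda>w. c * dd ?E z w)) (at z)"
      by (intro has_derivative_mult_right smooth_on_has_derivative[OF E that])
    then show ?thesis
      using dd_cong_open[OF open_W that RF] by (simp add: dd_eqI c_def)
  qed
  have dd2R: "dd2 R z u w = c * dd2 ?E z u w" if "z \<in> W" for z u w
  proof -
    have "((\<lambda>x. c * dd ?E x w) has_derivative (\<lambda>u. c * dd2 ?E z u w)) (at z)"
      by (intro has_derivative_mult_right smooth_on_has_derivative[OF smooth_on_dd[OF E] that])
    then show ?thesis
      using dd_cong_open[OF open_W that ddR] by (simp add: dd_eqI)
  qed
  have euler: "dd ?E z (0, snd z) = 2 * ?E z" if z: "z \<in> W" for z
  proof -
    have "fst z \<in> U" "snd z \<noteq> 0" "(fst z, snd z) \<in> W" using z by auto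
    then have "dd F (fst z, snd z) (0, snd z) = F (fst z, snd z)"
      by (intro homogeneous_imp_euler[OF F] hom)
    then show ?thesis
      unfolding dd_power2[OF F z] by (simp add: power2_eq_square)
  qed
  show "rank (fundamental_tensor F z) = CARD('n) \<longleftrightarrow>
       form_rank (d1 (dL tangent_structure R)) z = 2 * CARD('n)" if z: "z \<in> W"
    using rank_fundamental_tensor_full_iff[OF open_W E z refl] form_rank_ddJ_full_iff[OF open_W R z]
    by (simp add: dd2R[OF z] c)
  show "(\<forall>z\<in>W. \<forall>w. d1 (dL tangent_structure ?E) z (S z) w = - d0 ?E z w) \<longleftrightarrow>
       (\<forall>z\<in>W. \<forall>w. dL (horizontal_proj S) R z w = 0)"
  proof -
    have "dL (horizontal_proj S) R z w = 0 \<longleftrightarrow> dL (horizontal_proj S) ?E z w = 0" if "z \<in> W" for z w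
      using c by (simp add: dL_def d0_def ddR[OF that])
    then have "(\<forall>z\<in>W. \<forall>w. dL (horizontal_proj S) ?E z w = 0) \<longleftrightarrow>
        (\<forall>z\<in>W. \<forall>w. dL (horizontal_proj S) R z w = 0)"
      by (intro ball_cong all_cong1 refl) simp
    moreover have "(\<forall>z\<in>W. \<forall>w. d1 (dL tangent_structure ?E) z (S z) w = - d0 ?E z w) \<longleftrightarrow>
       (\<forall>z\<in>W. \<forall>w. dL (horizontal_proj S) ?E z w = 0)"
      by (rule metrizable_iff_horizontal[OF E euler])
    ultimately show ?thesis by (simp only:)
  qed
  show "jacobi_endo S z w = \<kappa> *\<^sub>R (?E z *\<^sub>R tangent_structure z w
                    - (F z * dL tangent_structure F z w) *\<^sub>R liouville z) \<longleftrightarrow>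
       (2 * (real CARD('n) - 1)) *\<^sub>R jacobi_endo S z w - (2 * R z) *\<^sub>R tangent_structure z w
              + dL tangent_structure R z w *\<^sub>R liouville z = 0" (is "?P = ?K \<longleftrightarrow> ?D = 0") if z: "z \<in> W"
  proof -
    have "?D = (2 * (real CARD('n) - 1)) *\<^sub>R (?P - ?K)"
      by (simp add: RF[OF z] dL_def d0_def ddR[OF z] dd_power2[OF F z] c_def algebra_simps)
    moreover have "2 * (real CARD('n) - 1) \<noteq> 0" using n by simp
    ultimately show ?thesis by (simp only: scaleR_eq_0_iff) simp
  qed
qed

text \<open>The trace of (\<open>D\<^sub>1\<close>) is \<open>2(n - 1) R - 2 n R + \<C>(R) = 0\<close> for \<open>R = Tr \<Phi>\<close>.\<close>

lemma D1_imp_euler: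
  fixes S :: "'e::euclidean_space \<times> 'e \<Rightarrow> 'e \<times> 'e"
  defines "R \<equiv> semibasic_trace (jacobi_endo S)"
  assumes R: "smooth_on W R" and z: "z \<in> W"
    and D1: "\<And>w. (2 * (real DIM('e) - 1)) *\<^sub>R jacobi_endo S z w - (2 * R z) *\<^sub>R tangent_structure z w
              + dL tangent_structure R z w *\<^sub>R liouville z = 0"
  shows "dd R z (0, snd z) = 2 * R z"
proof -
  let ?n = "real DIM('e)"
  note e = sum_vertical_basis[OF dd_linear[OF R z], of "snd z"]
  have "2 * (?n - 1) * (snd (jacobi_endo S z (b, 0)) \<bullet> b) - 2 * R z + (snd z \<bullet> b) * dd R z (0, b) = 0"
    if "b \<in> Basis" for b :: 'e
    using arg_cong[OF D1[of "(b, 0)"], of "\<lambda>v. snd v \<bullet> b"] that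
    by (simp add: tangent_structure_def liouville_def dL_def d0_def algebra_simps inner_commute)
  then have "(\<Sum>b\<in>Basis. 2 * (?n - 1) * (snd (jacobi_endo S z (b, 0)) \<bullet> b) - 2 * R z + (snd z \<bullet> b) * dd R z (0, b)) = 0"
    by (rule sum.neutral[OF ballI])
  then have "2 * (?n - 1) * R z - ?n * (2 * R z) + dd R z (0, snd z) = 0"
    by (simp only: sum.distrib sum_subtractf e sum_distrib_left[symmetric] sum_constant)
      (simp add: R_def semibasic_trace_def)
  then show ?thesis by (simp add: algebra_simps)
qed

text \<open>Only the points \<open>(x\<^sub>0, 0)\<close> are in question. A bound \<open>B\<close> for \<open>\<bar>f\<bar>\<close> on the compact set of unit vectors over a
  small closed ball around \<open>x\<^sub>0\<close> yields \<open>\<bar>f(x, y)\<bar> \<le> B \<parallel>y\<parallel>\<close> by homogeneity.\<close>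

lemma continuous_on_homogeneous:
  fixes f :: "'e::euclidean_space \<times> 'e \<Rightarrow> real"
  assumes U: "open U" and f: "continuous_on (U \<times> -{0}) f"
    and hom: "\<And>x y t. x \<in> U \<Longrightarrow> t \<ge> 0 \<Longrightarrow> f (x, t *\<^sub>R y) = t * f (x, y)"
  shows "continuous_on (U \<times> UNIV) f"
proof (rule continuous_at_imp_continuous_on, safe)
  fix x0 y0 :: 'e assume x0: "x0 \<in> U"
  show "isCont f (x0, y0)"
  proof (cases "y0 = 0")
    case False
    have "open (U \<times> -{0::'e})" using U by (intro open_Times) auto
    with f False x0 show ?thesis by (simp add: continuous_on_eq_continuous_at)
  next
    case True
    obtain r where r: "r > 0" "cball x0 r \<subseteq> U" using U x0 open_contains_cball by blast
    have "compact (f ` (cball x0 r \<times> sphere 0 1))"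
      by (intro compact_continuous_image continuous_on_subset[OF f] compact_Times) (use r in auto)
    then obtain B where B: "\<And>z. z \<in> cball x0 r \<times> sphere 0 1 \<Longrightarrow> \<bar>f z\<bar> \<le> B"
      by (metis compact_imp_bounded bounded_iff imageI real_norm_def)
    have f0: "f (x, 0) = 0" if "x \<in> U" for x using hom[OF that, of 0 0] by simp
    have bound: "\<bar>f z\<bar> \<le> B * norm (snd z)" if "fst z \<in> ball x0 r" for z
    proof (cases "snd z = 0")
      case True
      have "fst z \<in> U" using that r by (auto simp: subset_iff)
      with True f0[of "fst z"] show ?thesis by (metis abs_zero mult_zero_right norm_zero order_refl prod.collapse)
    next
      case False
      have "fst z \<in> U" using that r by (auto simp: subset_iff)
      from hom[OF this, of "norm (snd z)" "snd z /\<^sub>R norm (snd z)"] False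
      have "f z = norm (snd z) * f (fst z, snd z /\<^sub>R norm (snd z))" by simp
      moreover have "\<bar>f (fst z, snd z /\<^sub>R norm (snd z))\<bar> \<le> B"
        by (rule B) (use that False in auto)
      then have "norm (snd z) * \<bar>f (fst z, snd z /\<^sub>R norm (snd z))\<bar> \<le> norm (snd z) * B"
        by (intro mult_left_mono) auto
      ultimately show ?thesis by (simp add: abs_mult mult.commute)
    qed
    have "open (ball x0 r \<times> (UNIV::'e set))" by (intro open_Times) auto
    then have "eventually (\<lambda>z. z \<in> ball x0 r \<times> (UNIV::'e set)) (at (x0, 0))"
      by (rule eventually_at_in_open') (use r in auto)
    then have "eventually (\<lambda>z. norm (f z) \<le> B * norm (snd z)) (at (x0, 0))"
      by eventually_elim (use bound in auto)
    moreover have "((\<lambda>z::'e\<times>'e. B * norm (snd z)) \<longlongrightarrow> 0) (at (x0, 0))"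
      by (auto intro!: tendsto_eq_intros)
    ultimately have "(f \<longlongrightarrow> 0) (at (x0, 0))" by (rule Lim_null_comparison)
    then show ?thesis using True f0[OF x0] by (simp add: continuous_at)
  qed
qed

section \<open>Induced charts of the tangent bundle\<close>

locale manifold =
  fixes X :: "'a topology" and A :: "('i, 'a, 'e::euclidean_space) atlas"
  assumes smooth_manifold: "smooth_manifold X A"
begin

abbreviation "transition i j \<equiv> Crd A j \<circ> chart_inv A i"
abbreviation "overlap i j \<equiv> Crd A i ` (Dom A i \<inter> Dom A j)"
abbreviation "SB \<equiv> slit_tangent_bundle A"
abbreviation "TB \<equiv> tangent_bundle A"

lemma topspace_eq_points: "topspace X = points A"
  using smooth_manifold by (simp add: smooth_manifold_def)

context
  fixes i assumes i: "i \<in> Index A"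
begin

lemma openin_Dom: "openin X (Dom A i)" and open_image: "open (chart_image A i)"
  and homeo: "homeomorphic_map (subtopology X (Dom A i)) (top_of_set (chart_image A i)) (Crd A i)"
  using smooth_manifold i by (auto simp: smooth_manifold_def)

lemma topspace_Dom: "topspace (subtopology X (Dom A i)) = Dom A i"
  using openin_subset[OF openin_Dom] by (simp add: topspace_subtopology Int_absorb1)

lemma inj_Crd: "inj_on (Crd A i) (Dom A i)"
  using homeomorphic_imp_injective_map[OF homeo] by (simp only: topspace_Dom)

lemma chart_inv_Crd: "p \<in> Dom A i \<Longrightarrow> chart_inv A i (Crd A i p) = p"
  unfolding chart_inv_def by (rule inv_into_f_f[OF inj_Crd])

lemma Crd_in: "p \<in> Dom A i \<Longrightarrow> Crd A i p \<in> chart_image A i"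
  by (simp add: chart_image_def)

lemma chart_inv_in: "x \<in> chart_image A i \<Longrightarrow> chart_inv A i x \<in> Dom A i"
  and Crd_chart_inv: "x \<in> chart_image A i \<Longrightarrow> Crd A i (chart_inv A i x) = x"
  unfolding chart_image_def chart_inv_def by (auto intro: inv_into_into f_inv_into_f)

lemma openin_chart_preimage:
  assumes "open Y" shows "openin X {p \<in> Dom A i. Crd A i p \<in> Y}"
proof -
  have "openin (top_of_set (chart_image A i)) (chart_image A i \<inter> Y)"
    using assms by (simp add: openin_open_Int)
  from openin_continuous_map_preimage[OF homeomorphic_imp_continuous_map[OF homeo] this]
  have "openin (subtopology X (Dom A i)) {p \<in> Dom A i. Crd A i p \<in> chart_image A i \<inter> Y}"
    by (simp only: topspace_Dom)
  then have "openin X {p \<in> Dom A i. Crd A i p \<in> chart_image A i \<inter> Y}"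
    using openin_Dom by (simp add: openin_open_subtopology)
  moreover have "{p \<in> Dom A i. Crd A i p \<in> chart_image A i \<inter> Y} = {p \<in> Dom A i. Crd A i p \<in> Y}"
    using Crd_in by blast
  ultimately show ?thesis by (simp only:)
qed

lemma open_chart_image_of:
  assumes "openin X P" shows "open (Crd A i ` (Dom A i \<inter> P))"
proof -
  have "openin (subtopology X (Dom A i)) (Dom A i \<inter> P)"
    using assms by (rule openin_subtopology_Int2)
  with homeomorphic_imp_open_map[OF homeo]
  have "openin (top_of_set (chart_image A i)) (Crd A i ` (Dom A i \<inter> P))"
    by (simp add: open_map_def)
  then show ?thesis using open_image by (simp add: openin_open_eq)
qed

end

lemma overlap_subset: "overlap i j \<subseteq> chart_image A i"
  by (auto simp: chart_image_def)

lemma open_overlap: "i \<in> Index A \<Longrightarrow> j \<in> Index A \<Longrightarrow> open (overlap i j)"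
  by (intro open_chart_image_of openin_Dom)

lemma smooth_trans: "i \<in> Index A \<Longrightarrow> j \<in> Index A \<Longrightarrow> smooth_on (overlap i j) (transition i j)"
  using smooth_manifold by (auto simp: smooth_manifold_def)

lemma trans_Crd: "i \<in> Index A \<Longrightarrow> p \<in> Dom A i \<Longrightarrow> transition i j (Crd A i p) = Crd A j p"
  by (simp add: chart_inv_Crd)

lemma dd_trans_self:
  assumes i: "i \<in> Index A" and p: "p \<in> Dom A i"
  shows "dd (transition i i) (Crd A i p) v = v"
proof -
  have "dd (transition i i) (Crd A i p) = dd (\<lambda>x. x) (Crd A i p)"
    by (rule dd_cong_open[OF open_image[OF i] Crd_in[OF i p]]) (simp add: Crd_chart_inv[OF i])
  then show ?thesis by simp
qed

text \<open>The chain rule for transition maps: the cocycle property that makes \<open>lift\<close> below a tangent vector.\<close>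

lemma dd_trans_trans:
  assumes i: "i \<in> Index A" "p \<in> Dom A i" and j: "j \<in> Index A" "p \<in> Dom A j" and k: "k \<in> Index A" "p \<in> Dom A k"
  shows "dd (transition j k) (Crd A j p) (dd (transition i j) (Crd A i p) v) = dd (transition i k) (Crd A i p) v"
proof -
  let ?x = "Crd A i p"
  have xj: "?x \<in> overlap i j" and yk: "Crd A j p \<in> overlap j k" using assms by auto
  have d: "(transition i j has_derivative dd (transition i j) ?x) (at ?x)"
    by (rule smooth_on_has_derivative[OF smooth_trans[OF i(1) j(1)] xj])
  have "(transition j k has_derivative dd (transition j k) (Crd A j p)) (at (transition i j ?x))"
    unfolding trans_Crd[OF i] by (rule smooth_on_has_derivative[OF smooth_trans[OF j(1) k(1)] yk])
  from has_derivative_compose[OF d this]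
  have "((\<lambda>x. transition j k (transition i j x)) has_derivative (\<lambda>v. dd (transition j k) (Crd A j p) (dd (transition i j) ?x v))) (at ?x)" .
  then have "(transition i k has_derivative (\<lambda>v. dd (transition j k) (Crd A j p) (dd (transition i j) ?x v))) (at ?x)"
    by (rule has_derivative_transform_within_open[OF _ open_overlap[OF i(1) j(1)] xj])
      (auto simp: chart_inv_Crd[OF i(1)] chart_inv_Crd[OF j(1)])
  from dd_eqI[OF this] show ?thesis by simp
qed

lemma dd_trans_nonzero:
  assumes i: "i \<in> Index A" "p \<in> Dom A i" and j: "j \<in> Index A" "p \<in> Dom A j" and v: "v \<noteq> 0"
  shows "dd (transition i j) (Crd A i p) v \<noteq> 0"
proof
  assume 0: "dd (transition i j) (Crd A i p) v = 0"
  have "Crd A j p \<in> overlap j i" using i j by auto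
  then have "dd (transition j i) (Crd A j p) 0 = 0"
    by (intro linear_0 dd_linear[OF smooth_trans[OF j(1) i(1)]])
  with dd_trans_trans[OF i j i, of v] dd_trans_self[OF i, of v] 0 v show False by simp
qed

text \<open>The tangent vector at \<open>p\<close> whose component in the \<open>i\<close>-th chart is \<open>y\<close>. It describes the inverse of the
  induced chart of the tangent bundle.\<close>

definition lift :: "'i \<Rightarrow> 'a \<Rightarrow> 'e \<Rightarrow> 'i \<Rightarrow> 'e" where
  "lift i p y = (\<lambda>j. if j \<in> Index A \<and> p \<in> Dom A j then dd (transition i j) (Crd A i p) y else 0)"

context
  fixes i p assumes i: "i \<in> Index A" and p: "p \<in> Dom A i"
begin

lemma lift_in_tangent_space: "lift i p y \<in> tangent_space A p"
  by (auto simp: tangent_space_def lift_def dd_trans_trans[OF i p])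

lemma lift_component: "lift i p y i = y"
  using i p by (simp add: lift_def dd_trans_self)

lemma tangent_space_eq_lift:
  assumes v: "v \<in> tangent_space A p" shows "v = lift i p (v i)"
proof
  fix j
  have "j \<in> Index A \<Longrightarrow> p \<in> Dom A j \<Longrightarrow> v j = dd (transition i j) (Crd A i p) (v i)"
    using v i p unfolding tangent_space_def by blast
  moreover have "\<not> (j \<in> Index A \<and> p \<in> Dom A j) \<Longrightarrow> v j = 0"
    using v unfolding tangent_space_def by blast
  ultimately show "v j = lift i p (v i) j"
    unfolding lift_def by metis
qed

lemma lift_nonzero: "y \<noteq> 0 \<Longrightarrow> lift i p y \<noteq> (\<lambda>_. 0)"
  using lift_component by metis

lemma tangent_space_eq_0_iff:
  assumes "v \<in> tangent_space A p" shows "v = (\<lambda>_. 0) \<longleftrightarrow> v i = 0"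
proof
  assume "v i = 0"
  then have "v = lift i p 0" using tangent_space_eq_lift[OF assms] by simp
  moreover have "lift i p 0 j = 0" for j
    using i p linear_0[OF dd_linear[OF smooth_trans[OF i, of j], of "Crd A i p"]] by (auto simp: lift_def)
  ultimately show "v = (\<lambda>_. 0)" by auto
qed simp

end

lemma tangent_space_scale:
  assumes v: "v \<in> tangent_space A p"
  shows "(\<lambda>i. t *\<^sub>R v i) \<in> tangent_space A p"
proof -
  have "t *\<^sub>R v j = dd (transition i j) (Crd A i p) (t *\<^sub>R v i)"
    if "i \<in> Index A" "j \<in> Index A" "p \<in> Dom A i" "p \<in> Dom A j" for i j
  proof -
    have "dd (transition i j) (Crd A i p) (t *\<^sub>R v i) = t *\<^sub>R dd (transition i j) (Crd A i p) (v i)"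
      using that by (intro linear_scale dd_linear[OF smooth_trans]) auto
    moreover have "v j = dd (transition i j) (Crd A i p) (v i)"
      using v that unfolding tangent_space_def by blast
    ultimately show ?thesis by (simp only:)
  qed
  moreover have "t *\<^sub>R v i = 0" if "\<not> (i \<in> Index A \<and> p \<in> Dom A i)" for i
    using v that unfolding tangent_space_def by simp
  ultimately show ?thesis unfolding tangent_space_def by blast
qed

lemma lift_scale:
  assumes "i \<in> Index A" "p \<in> Dom A i"
  shows "(\<lambda>j. t *\<^sub>R lift i p y j) = lift i p (t *\<^sub>R y)"
  using tangent_space_eq_lift[OF assms tangent_space_scale[OF lift_in_tangent_space[OF assms], of t]]
    lift_component[OF assms] by simp

lemma Dom_SB: "(p, v) \<in> Dom SB i \<longleftrightarrow> p \<in> Dom A i \<and> v \<in> tangent_space A p \<and> v \<noteq> (\<lambda>_. 0)"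
  and Dom_TB: "(p, v) \<in> Dom TB i \<longleftrightarrow> p \<in> Dom A i \<and> v \<in> tangent_space A p"
  and Crd_SB: "Crd SB i (p, v) = (Crd A i p, v i)" and Crd_TB: "Crd TB i (p, v) = (Crd A i p, v i)"
  and Index_SB: "Index SB = Index A" and Index_TB: "Index TB = Index A"
  by (auto simp: slit_tangent_bundle_def tangent_bundle_def)

lemma inj_Crd_TB: assumes "i \<in> Index A" shows "inj_on (Crd TB i) (Dom TB i)"
proof (rule inj_onI)
  fix q r assume q: "q \<in> Dom TB i" and r: "r \<in> Dom TB i" and eq: "Crd TB i q = Crd TB i r"
  obtain p v p' v' where pv: "q = (p, v)" "r = (p', v')" by (cases q, cases r)
  have "p = p'" using q r eq inj_onD[OF inj_Crd[OF assms]] by (simp add: pv Dom_TB Crd_TB)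
  then show "q = r"
    using q r eq tangent_space_eq_lift[OF assms, of p v] tangent_space_eq_lift[OF assms, of p v']
    by (simp add: pv Dom_TB Crd_TB)
qed

lemma inj_Crd_SB: assumes "i \<in> Index A" shows "inj_on (Crd SB i) (Dom SB i)"
proof -
  have "inj_on (Crd TB i) (Dom SB i)"
    by (rule inj_on_subset[OF inj_Crd_TB[OF assms]]) (auto simp: Dom_SB Dom_TB)
  then show ?thesis by (simp add: slit_tangent_bundle_def tangent_bundle_def)
qed

context
  fixes i assumes i: "i \<in> Index A"
begin

lemma lift_in_TB: "x \<in> chart_image A i \<Longrightarrow> (chart_inv A i x, lift i (chart_inv A i x) y) \<in> Dom TB i"
  and Crd_lift_TB: "x \<in> chart_image A i \<Longrightarrow> Crd TB i (chart_inv A i x, lift i (chart_inv A i x) y) = (x, y)"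
  by (simp_all add: Dom_TB Crd_TB chart_inv_in[OF i] lift_in_tangent_space[OF i] lift_component[OF i] Crd_chart_inv[OF i])

lemma lift_in_SB: "x \<in> chart_image A i \<Longrightarrow> y \<noteq> 0 \<Longrightarrow> (chart_inv A i x, lift i (chart_inv A i x) y) \<in> Dom SB i"
  and Crd_lift_SB: "x \<in> chart_image A i \<Longrightarrow> Crd SB i (chart_inv A i x, lift i (chart_inv A i x) y) = (x, y)"
  by (simp_all add: Dom_SB Crd_SB chart_inv_in[OF i] lift_in_tangent_space[OF i]
     lift_nonzero[OF i] lift_component[OF i] Crd_chart_inv[OF i])

lemma chart_image_TB: "chart_image TB i = chart_image A i \<times> UNIV"
proof -
  have "(x, y) \<in> chart_image TB i" if "x \<in> chart_image A i" for x y
    using imageI[OF lift_in_TB[OF that, of y], of "Crd TB i"]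
    unfolding chart_image_def[of TB] Crd_lift_TB[OF that] .
  moreover have "z \<in> chart_image A i \<times> UNIV" if "z \<in> chart_image TB i" for z
    using that Crd_in[OF i] by (auto simp: chart_image_def[of TB] Dom_TB Crd_TB)
  ultimately show ?thesis by auto
qed

lemma chart_image_SB: "chart_image SB i = chart_image A i \<times> -{0}"
proof -
  have "(x, y) \<in> chart_image SB i" if "x \<in> chart_image A i" "y \<noteq> 0" for x y
    using imageI[OF lift_in_SB[OF that], of "Crd SB i"]
    unfolding chart_image_def[of SB] Crd_lift_SB[OF that(1)] .
  moreover have "z \<in> chart_image A i \<times> -{0}" if "z \<in> chart_image SB i" for z
    using that Crd_in[OF i] tangent_space_eq_0_iff[OF i] by (auto simp: chart_image_def[of SB] Dom_SB Crd_SB)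
  ultimately show ?thesis by auto
qed

lemma chart_inv_TB: "x \<in> chart_image A i \<Longrightarrow> chart_inv TB i (x, y) = (chart_inv A i x, lift i (chart_inv A i x) y)"
  unfolding chart_inv_def[of TB] by (rule inv_into_f_eq[OF inj_Crd_TB[OF i] lift_in_TB Crd_lift_TB])

lemma chart_inv_SB:
  "x \<in> chart_image A i \<Longrightarrow> y \<noteq> 0 \<Longrightarrow> chart_inv SB i (x, y) = (chart_inv A i x, lift i (chart_inv A i x) y)"
  unfolding chart_inv_def[of SB] by (rule inv_into_f_eq[OF inj_Crd_SB[OF i] lift_in_SB Crd_lift_SB])

lemma Crd_SB_in: "q \<in> Dom SB i \<Longrightarrow> Crd SB i q \<in> chart_image A i \<times> -{0}"
  using chart_image_SB by (auto simp: chart_image_def[of SB])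

lemma chart_inv_Crd_SB: "q \<in> Dom SB i \<Longrightarrow> chart_inv SB i (Crd SB i q) = q"
  unfolding chart_inv_def[of SB] by (rule inv_into_f_eq[OF inj_Crd_SB[OF i]]) auto

end

text \<open>The relation between the components of a tangent vector of the slit tangent bundle is stated
  with the transition maps of the induced charts. This turns it into relatedness by \<open>tangent_map\<close>.\<close>

lemma SB_transition:
  assumes i: "i \<in> Index A" and j: "j \<in> Index A" and z: "z \<in> overlap i j \<times> -{0}"
  shows "chart_inv SB i z \<in> Dom SB i" "chart_inv SB i z \<in> Dom SB j"
    "Crd SB i (chart_inv SB i z) = z" "Crd SB j (chart_inv SB i z) = tangent_map (transition i j) z"
proof -
  obtain p y where zp: "z = (Crd A i p, y)" and p: "p \<in> Dom A i" "p \<in> Dom A j" and y: "y \<noteq> 0" using z by auto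
  have q: "chart_inv SB i z = (p, lift i p y)"
    by (simp add: zp chart_inv_SB[OF i Crd_in[OF i p(1)] y] chart_inv_Crd[OF i p(1)])
  have t: "lift i p y \<in> tangent_space A p" by (rule lift_in_tangent_space[OF i p(1)])
  have c: "lift i p y i = y" by (rule lift_component[OF i p(1)])
  show "chart_inv SB i z \<in> Dom SB i" "chart_inv SB i z \<in> Dom SB j"
    unfolding q Dom_SB using p t lift_nonzero[OF i p(1) y] by simp_all
  show "Crd SB i (chart_inv SB i z) = z" unfolding q Crd_SB c by (simp only: zp)
  show "Crd SB j (chart_inv SB i z) = tangent_map (transition i j) z"
    unfolding q Crd_SB unfolding tangent_map_def zp using j p by (simp add: lift_def chart_inv_Crd[OF i p(1)])
qed

end

section \<open>The Ricci curvature on the slit tangent bundle\<close>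

locale spray_manifold = manifold X A for X :: "'a topology" and A :: "('i, 'a, 'e::euclidean_space) atlas" +
  fixes S :: "'a \<times> ('i \<Rightarrow> 'e) \<Rightarrow> 'i \<Rightarrow> 'e \<times> 'e"
  assumes spray: "spray A S"
begin

abbreviation "rep i \<equiv> field_rep SB S i"

lemma local_spray: assumes i: "i \<in> Index A" shows "local_spray (chart_image A i) (rep i)"
  using spray i open_image[OF i] unfolding spray_def smooth_vector_field_def Index_SB Let_def
  by unfold_locales (auto simp flip: chart_image_SB)

lemma spray_transition:
  assumes i: "i \<in> Index A" and j: "j \<in> Index A"
  shows "spray_transition (chart_image A i) (rep i) (chart_image A j) (rep j) (overlap i j) (transition i j)"
proof (intro spray_transition.intro spray_transition_axioms.intro local_spray i j)
  show "open (overlap i j)" by (rule open_overlap[OF i j])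
  show "overlap i j \<subseteq> chart_image A i" by (rule overlap_subset)
  show "smooth_on (overlap i j) (transition i j)" by (rule smooth_trans[OF i j])
  show "transition i j x \<in> chart_image A j" if "x \<in> overlap i j" for x
    using that trans_Crd[OF i] Crd_in[OF j] by auto
  show "dd (transition i j) x w \<noteq> 0" if "x \<in> overlap i j" "w \<noteq> 0" for x w
    using that dd_trans_nonzero[OF i _ j] by auto
  show "rep j (tangent_map (transition i j) z) = dd (tangent_map (transition i j)) z (rep i z)"
    if z: "z \<in> overlap i j \<times> -{0}" for z
  proof -
    let ?q = "chart_inv SB i z"
    note q = SB_transition[OF i j z]
    have inv: "chart_inv SB j (tangent_map (transition i j) z) = ?q"
      using chart_inv_Crd_SB[OF j q(2)] q(4) by simp
    have "?q \<in> points SB" using q(1) i by (auto simp: points_def Index_SB)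
    then have "S ?q \<in> tangent_space SB ?q"
      using spray by (auto simp: spray_def smooth_vector_field_def)
    then have "S ?q j = dd (Crd SB j \<circ> chart_inv SB i) (Crd SB i ?q) (S ?q i)"
      using i j q(1,2) unfolding tangent_space_def Index_SB by blast
    \<comment> \<open>the two maps agree on the open set over the overlap, hence so do their derivatives\<close>
    moreover have "dd (Crd SB j \<circ> chart_inv SB i) z = dd (tangent_map (transition i j)) z"
    proof (rule dd_cong_open[OF _ z])
      show "open (overlap i j \<times> -{0::'e})" using open_overlap[OF i j] by (intro open_Times) auto
    qed (use SB_transition(4)[OF i j] in simp)
    ultimately show ?thesis by (simp add: field_rep_def inv q(3))
  qed
qed

lemma Ric_rep_transition:
  assumes i: "i \<in> Index A" and j: "j \<in> Index A" and z: "z \<in> overlap i j \<times> -{0}"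
  shows "Ric_rep A S j (tangent_map (transition i j) z) = Ric_rep A S i z"
  using spray_transition.ricci_transition[OF spray_transition[OF i j] z]
  by (simp add: Ric_rep_def Jacobi_rep_def)

lemma Ric_rep_invariant:
  assumes i: "i \<in> Index A" "q \<in> Dom SB i" and j: "j \<in> Index A" "q \<in> Dom SB j"
  shows "Ric_rep A S j (Crd SB j q) = Ric_rep A S i (Crd SB i q)"
proof -
  have "fst q \<in> Dom A i \<inter> Dom A j" using i j Dom_SB by (cases q) auto
  moreover have "snd (Crd SB i q) \<noteq> 0" using Crd_SB_in[OF i] by auto
  moreover have "fst (Crd SB i q) = Crd A i (fst q)" by (cases q) (simp add: Crd_SB)
  ultimately have z: "Crd SB i q \<in> overlap i j \<times> -{0}" by (auto simp: mem_Times_iff)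
  from Ric_rep_transition[OF i(1) j(1) z] SB_transition(4)[OF i(1) j(1) z] chart_inv_Crd_SB[OF i]
  show ?thesis by simp
qed

lemma smooth_Ric_rep: "i \<in> Index A \<Longrightarrow> smooth_on (chart_image A i \<times> -{0}) (Ric_rep A S i)"
  using local_spray.smooth_ricci[OF local_spray] by (simp add: Ric_rep_def Jacobi_rep_def)

text \<open>On each punctured fibre the sign is constant, as a punctured vector space of dimension at
  least 2 is connected. By chart invariance the points of \<open>M\<close> over which the sign is positive, respectively
  negative, form two disjoint open sets that cover \<open>M\<close>, so one of them is empty.\<close>

lemma Ric_constant_sign:
  assumes conn: "connected_space X" and dim: "DIM('e) \<ge> 2"
    and nz: "\<And>i z. i \<in> Index A \<Longrightarrow> z \<in> chart_image A i \<times> -{0} \<Longrightarrow> Ric_rep A S i z \<noteq> 0"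
  obtains \<epsilon> :: real where "\<bar>\<epsilon>\<bar> = 1"
    "\<And>i z. i \<in> Index A \<Longrightarrow> z \<in> chart_image A i \<times> -{0} \<Longrightarrow> \<epsilon> * Ric_rep A S i z > 0"
proof -
  \<comment> \<open>\<open>P 1\<close> and \<open>P (-1)\<close> are the sets of base points with positive and with negative sign somewhere on the fibre\<close>
  define P where "P = (\<lambda>s. {p. \<exists>i\<in>Index A. p \<in> Dom A i \<and> (\<exists>y. y \<noteq> 0 \<and> s * Ric_rep A S i (Crd A i p, y) > 0)})"
  have cont: "continuous_on (chart_image A i \<times> -{0}) (Ric_rep A S i)" if "i \<in> Index A" for i
    by (rule smooth_on_continuous[OF smooth_Ric_rep[OF that]])
  have fibre: "s * Ric_rep A S i (x, y') > 0"
    if i: "i \<in> Index A" and x: "x \<in> chart_image A i" and y: "y \<noteq> 0" "y' \<noteq> 0"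
      and pos: "s * Ric_rep A S i (x, y) > 0" for i x y y' and s :: real
  proof (rule ccontr)
    let ?g = "\<lambda>y. s * Ric_rep A S i (x, y)"
    assume "\<not> ?g y' > 0"
    have "connected (?g ` (-{0}))"
      by (intro connected_continuous_image connected_punctured_universe continuous_intros
          continuous_on_compose2[OF cont[OF i]]) (use x dim in auto)
    moreover have "?g y' \<in> ?g ` (-{0})" "?g y \<in> ?g ` (-{0})" using y by (intro imageI; simp)+
    moreover have "?g y' \<le> 0" "0 \<le> ?g y" using pos \<open>\<not> ?g y' > 0\<close> by linarith+
    ultimately have "0 \<in> ?g ` (-{0})" by (rule connectedD_interval)
    then obtain y0 where y0: "0 = ?g y0" "y0 \<in> -{0}" by (rule imageE)
    have "s \<noteq> 0" using pos by auto
    then show False using nz[OF i, of "(x, y0)"] x y0 by simp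
  qed
  have openP: "openin X (P s)" for s
  proof -
    have "P s = (\<Union>i\<in>Index A. \<Union>y\<in>-{0}. {p \<in> Dom A i. Crd A i p \<in> {x \<in> chart_image A i. s * Ric_rep A S i (x, y) \<in> {0<..}}})"
      using Crd_in by (auto simp: P_def)
    moreover have "open {x \<in> chart_image A i. s * Ric_rep A S i (x, y) \<in> {0<..}}" if "i \<in> Index A" "y \<noteq> 0" for i y
    proof -
      have "continuous_on (chart_image A i) (\<lambda>x. s * Ric_rep A S i (x, y))"
        by (intro continuous_intros continuous_on_compose2[OF cont[OF that(1)]]) (use that in auto)
      from continuous_open_preimage[OF this open_image[OF that(1)] open_greaterThan[of 0]]
      show ?thesis by (simp only: vimage_def Int_def mem_Collect_eq)
    qed
    ultimately show ?thesis
      by (simp only:) (intro openin_Union openin_chart_preimage; fastforce intro!: openin_Union openin_chart_preimage)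
  qed
  have disjoint: "P 1 \<inter> P (-1) = {}"
  proof (rule ccontr)
    assume "P 1 \<inter> P (-1) \<noteq> {}"
    then obtain p i j y y' where i: "i \<in> Index A" "p \<in> Dom A i" and j: "j \<in> Index A" "p \<in> Dom A j"
      and y: "y \<noteq> 0" "Ric_rep A S i (Crd A i p, y) > 0" and y': "y' \<noteq> 0" "Ric_rep A S j (Crd A j p, y') < 0"
      by (auto simp: P_def)
    let ?y = "dd (transition i j) (Crd A i p) y"
    have "(Crd A i p, y) \<in> overlap i j \<times> -{0}" using i j y by auto
    from Ric_rep_transition[OF i(1) j(1) this]
    have "Ric_rep A S j (Crd A j p, ?y) = Ric_rep A S i (Crd A i p, y)"
      by (simp add: tangent_map_def chart_inv_Crd[OF i])
    moreover have "?y \<noteq> 0" by (rule dd_trans_nonzero[OF i j y(1)])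
    ultimately show False
      using fibre[OF j(1) Crd_in[OF j], of ?y y' 1] y y' by simp
  qed
  have cover: "topspace X \<subseteq> P 1 \<union> P (-1)"
  proof
    fix p assume "p \<in> topspace X"
    then obtain i where i: "i \<in> Index A" "p \<in> Dom A i" by (auto simp: topspace_eq_points points_def)
    obtain b :: 'e where b: "b \<in> Basis" using nonempty_Basis by blast
    then have b0: "b \<noteq> 0" using nonzero_Basis by blast
    have "Ric_rep A S i (Crd A i p, b) \<noteq> 0" using nz[OF i(1)] Crd_in[OF i] b0 by auto
    then have "1 * Ric_rep A S i (Crd A i p, b) > 0 \<or> (-1) * Ric_rep A S i (Crd A i p, b) > 0" by linarith
    then show "p \<in> P 1 \<union> P (-1)" using i b0 unfolding P_def by blast
  qed
  have "P 1 = {} \<or> P (-1) = {}"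
    using conn openP disjoint cover unfolding connected_space_def by blast
  then have "\<exists>s::real. \<bar>s\<bar> = 1 \<and> P s = {}"
    by (metis abs_minus_cancel abs_one)
  then obtain s :: real where s: "\<bar>s\<bar> = 1" "P s = {}" by blast
  show ?thesis
  proof (rule that[of "-s"])
    show "\<bar>-s\<bar> = 1" using s by simp
    fix i and z :: "'e \<times> 'e" assume i: "i \<in> Index A" and z: "z \<in> chart_image A i \<times> -{0}"
    have p: "chart_inv A i (fst z) \<in> Dom A i" "Crd A i (chart_inv A i (fst z)) = fst z"
      using z chart_inv_in[OF i] Crd_chart_inv[OF i] by auto
    have "\<not> s * Ric_rep A S i z > 0"
    proof
      assume "s * Ric_rep A S i z > 0"
      then have "s * Ric_rep A S i (Crd A i (chart_inv A i (fst z)), snd z) > 0" by (simp add: p)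
      moreover have "snd z \<noteq> 0" using z by auto
      ultimately have "chart_inv A i (fst z) \<in> P s" using i p(1) unfolding P_def by blast
      then show False using s by simp
    qed
    moreover have "s * Ric_rep A S i z \<noteq> 0" using nz[OF i z] s by auto
    ultimately show "- s * Ric_rep A S i z > 0" by linarith
  qed
qed

end

section \<open>Metrizability by a Finsler function of constant flag curvature\<close>

theorem theorem4p1:
  fixes X :: "'a topology"
    and A :: "('i, 'a, real^'n) atlas"
    and S :: "'a \<times> ('i \<Rightarrow> real^'n) \<Rightarrow> 'i \<Rightarrow> (real^'n) \<times> (real^'n)"
  assumes "smooth_manifold X A"
    and "connected_space X"
    and "CARD('n) \<ge> 2"
    and "spray A S"
    and "\<forall>i\<in>Index A. \<forall>z\<in>chart_image (slit_tangent_bundle A) i. Ric_rep A S i z \<noteq> 0"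
  shows "(\<exists>F \<kappa>. finsler_function A F \<and> metrizable_by A S F \<and>
            \<kappa> \<noteq> 0 \<and> constant_flag_curvature A S F \<kappa>) \<longleftrightarrow>
         (\<forall>i\<in>Index A. \<forall>z\<in>chart_image (slit_tangent_bundle A) i.
            form_rank (d1 (dL tangent_structure (Ric_rep A S i))) z = 2 * CARD('n)) \<and>
         (\<forall>i\<in>Index A. \<forall>z\<in>chart_image (slit_tangent_bundle A) i. \<forall>w.
            (2 * (real CARD('n) - 1)) *\<^sub>R Jacobi_rep A S i z w
              - (2 * Ric_rep A S i z) *\<^sub>R tangent_structure z w
              + dL tangent_structure (Ric_rep A S i) z w *\<^sub>R liouville z = 0) \<and>
         (\<forall>i\<in>Index A. \<forall>z\<in>chart_image (slit_tangent_bundle A) i. \<forall>w.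
            dL (h_rep A S i) (Ric_rep A S i) z w = 0)" (is "?L \<longleftrightarrow> ?A \<and> ?D1 \<and> ?D2")
proof -
  interpret spray_manifold X A S
    by unfold_locales (use assms in auto)
  let ?m = "real CARD('n) - 1"
  have m: "?m > 0" using assms(3) by simp
  note reps = Ric_rep_def Jacobi_rep_def h_rep_def

  \<comment> \<open>\<open>local_equivalence\<close> in the \<open>i\<close>-th induced chart, each condition taken on the whole chart image\<close>
  have key: "(\<forall>z\<in>chart_image SB i. rank (fundamental_tensor (fun_rep SB F i) z) = CARD('n)) \<longleftrightarrow>
       (\<forall>z\<in>chart_image SB i. form_rank (d1 (dL tangent_structure (Ric_rep A S i))) z = 2 * CARD('n))" (is "?r")
    "(\<forall>z\<in>chart_image SB i. \<forall>w. d1 (dL tangent_structure (\<lambda>x. (fun_rep SB F i x)\<^sup>2)) z (rep i z) w = - d0 (\<lambda>x. (fun_rep SB F i x)\<^sup>2) z w) \<longleftrightarrow>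
       (\<forall>z\<in>chart_image SB i. \<forall>w. dL (h_rep A S i) (Ric_rep A S i) z w = 0)" (is "?me")
    "(\<forall>z\<in>chart_image SB i. \<forall>w. Jacobi_rep A S i z w = \<kappa> *\<^sub>R ((fun_rep SB F i z)\<^sup>2 *\<^sub>R tangent_structure z w
                    - (fun_rep SB F i z * dL tangent_structure (fun_rep SB F i) z w) *\<^sub>R liouville z)) \<longleftrightarrow>
       (\<forall>z\<in>chart_image SB i. \<forall>w. (2 * ?m) *\<^sub>R Jacobi_rep A S i z w - (2 * Ric_rep A S i z) *\<^sub>R tangent_structure z w
              + dL tangent_structure (Ric_rep A S i) z w *\<^sub>R liouville z = 0)" (is "?c")
    if i: "i \<in> Index A" and F: "smooth_on (chart_image SB i) (fun_rep SB F i)"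
      and hom: "\<And>x y t. x \<in> chart_image A i \<Longrightarrow> y \<noteq> 0 \<Longrightarrow> t > 0 \<Longrightarrow> fun_rep SB F i (x, t *\<^sub>R y) = t * fun_rep SB F i (x, y)"
      and \<kappa>: "\<kappa> \<noteq> 0" and RF: "\<And>z. z \<in> chart_image SB i \<Longrightarrow> Ric_rep A S i z = \<kappa> * ?m * (fun_rep SB F i z)\<^sup>2"
    for i F \<kappa>
  proof -
    note eq = local_equivalence[OF local_spray[OF i] assms(3) F[unfolded chart_image_SB[OF i]] hom \<kappa>
        RF[unfolded chart_image_SB[OF i] reps], folded reps]
    show ?r unfolding chart_image_SB[OF i] by (intro ball_cong refl eq(1))
    show ?me unfolding chart_image_SB[OF i] by (rule eq(2))
    show ?c unfolding chart_image_SB[OF i] by (intro ball_cong all_cong1 refl eq(3))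
  qed

  have scale_rep: "fun_rep SB F i (x, t *\<^sub>R y) = t * fun_rep SB F i (x, y)"
    if hom: "\<forall>(p, v)\<in>points TB. \<forall>t\<ge>0. F (p, \<lambda>i. t *\<^sub>R v i) = t * F (p, v)"
      and i: "i \<in> Index A" and x: "x \<in> chart_image A i" and y: "y \<noteq> 0" and t: "t > 0" for F :: "_ \<Rightarrow> real" and i x y t
  proof -
    let ?p = "chart_inv A i x"
    have p: "?p \<in> Dom A i" by (rule chart_inv_in[OF i x])
    note e = lift_scale[OF i p]
    have "(?p, lift i ?p y) \<in> points TB"
      using lift_in_TB[OF i x] i by (auto simp: points_def Index_TB)
    from bspec[OF hom this] have "F (?p, \<lambda>j. t *\<^sub>R lift i ?p y j) = t * F (?p, lift i ?p y)"
      using t by simp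
    then show ?thesis
      unfolding e using t y by (simp add: fun_rep_def chart_inv_SB[OF i x])
  qed

  show ?thesis
  proof
    assume ?L
    then obtain F \<kappa> where fin: "finsler_function A F" and met: "metrizable_by A S F" and \<kappa>: "\<kappa> \<noteq> 0"
      and flag: "constant_flag_curvature A S F \<kappa>" by blast
    have ok: "(\<forall>z\<in>chart_image SB i. form_rank (d1 (dL tangent_structure (Ric_rep A S i))) z = 2 * CARD('n)) \<and>
       (\<forall>z\<in>chart_image SB i. \<forall>w. (2 * ?m) *\<^sub>R Jacobi_rep A S i z w - (2 * Ric_rep A S i z) *\<^sub>R tangent_structure z w
              + dL tangent_structure (Ric_rep A S i) z w *\<^sub>R liouville z = 0) \<and>
       (\<forall>z\<in>chart_image SB i. \<forall>w. dL (h_rep A S i) (Ric_rep A S i) z w = 0)" if i: "i \<in> Index A" for i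
    proof -
      let ?F = "fun_rep SB F i"
      have F: "smooth_on (chart_image SB i) ?F"
        using fin i by (simp add: finsler_function_def smooth_fun_def Index_SB)
      have hom: "?F (x, t *\<^sub>R y) = t * ?F (x, y)" if "x \<in> chart_image A i" "y \<noteq> 0" "t > 0" for x y t
        using fin i that by (intro scale_rep) (auto simp: finsler_function_def)
      have \<Phi>: "Jacobi_rep A S i z w = \<kappa> *\<^sub>R ((?F z)\<^sup>2 *\<^sub>R tangent_structure z w
                    - (?F z * dL tangent_structure ?F z w) *\<^sub>R liouville z)" if "z \<in> chart_image SB i" for z w
        using flag i that unfolding constant_flag_curvature_def Let_def by blast
      have euler: "dd ?F z (0, snd z) = ?F z" if "z \<in> chart_image SB i" for z
      proof -
        have "fst z \<in> chart_image A i" "snd z \<noteq> 0" "(fst z, snd z) \<in> chart_image SB i"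
          using that unfolding chart_image_SB[OF i] by auto
        then have "dd ?F (fst z, snd z) (0, snd z) = ?F (fst z, snd z)"
          by (intro homogeneous_imp_euler[OF F] hom)
        then show ?thesis by simp
      qed
      have R: "Ric_rep A S i z = \<kappa> * ?m * (?F z)\<^sup>2" if "z \<in> chart_image SB i" for z
        using trace_constant_flag_curvature[where \<Phi>="Jacobi_rep A S i" and \<kappa>=\<kappa>, OF F that euler[OF that] \<Phi>[OF that]]
        by (simp add: Ric_rep_def)
      note eqs = key[OF i F hom \<kappa> R]
      have "\<forall>z\<in>chart_image SB i. rank (fundamental_tensor ?F z) = CARD('n)"
        using fin i by (simp add: finsler_function_def)
      moreover have "\<forall>z\<in>chart_image SB i. \<forall>w. d1 (dL tangent_structure (\<lambda>x. (?F x)\<^sup>2)) z (rep i z) w = - d0 (\<lambda>x. (?F x)\<^sup>2) z w"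
        using met i unfolding metrizable_by_def Let_def by blast
      ultimately show ?thesis using eqs \<Phi> by blast
    qed
    then show "?A \<and> ?D1 \<and> ?D2" by blast
  next
    assume conds: "?A \<and> ?D1 \<and> ?D2"
    have nz: "Ric_rep A S i z \<noteq> 0" if "i \<in> Index A" "z \<in> chart_image A i \<times> -{0}" for i z
      using assms(5)[rule_format, OF that(1), of z] that(2) unfolding chart_image_SB[OF that(1)] .
    obtain \<epsilon> :: real where \<epsilon>: "\<bar>\<epsilon>\<bar> = 1"
      and pos: "\<And>i z. i \<in> Index A \<Longrightarrow> z \<in> chart_image A i \<times> -{0} \<Longrightarrow> \<epsilon> * Ric_rep A S i z > 0"
      by (rule Ric_constant_sign[OF assms(2) _ nz]) (use assms(3) in auto)
    have \<epsilon>2: "\<epsilon> * \<epsilon> = 1" using \<epsilon> by (metis abs_mult_self_eq mult_1)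
    \<comment> \<open>any chart around \<open>p\<close> may be used, by invariance of the Ricci curvature (\<open>F_eq\<close>)\<close>
    define ch where "ch = (\<lambda>p. SOME i. i \<in> Index A \<and> p \<in> Dom A i)"
    define F where "F = (\<lambda>(p, v). if v = (\<lambda>_. 0) then 0 else
        sqrt (\<epsilon> * Ric_rep A S (ch p) (Crd SB (ch p) (p, v)) / ?m))"
    have F_eq: "F q = sqrt (\<epsilon> * Ric_rep A S i (Crd SB i q) / ?m)" if i: "i \<in> Index A" "q \<in> Dom SB i" for q i
    proof -
      obtain p v where q: "q = (p, v)" by fastforce
      have p: "p \<in> Dom A i" "v \<noteq> (\<lambda>_. 0)" "v \<in> tangent_space A p" using i by (auto simp: q Dom_SB)
      have "ch p \<in> Index A \<and> p \<in> Dom A (ch p)" unfolding ch_def by (rule someI[of _ i]) (use i p in auto)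
      then show ?thesis using Ric_rep_invariant[OF i, of "ch p"] p by (simp add: F_def q Dom_SB)
    qed
    have F_rep: "fun_rep SB F i z = sqrt (\<epsilon> * Ric_rep A S i z / ?m)" if i: "i \<in> Index A" and z: "z \<in> chart_image A i \<times> -{0}" for i z
    proof -
      obtain x y where xy: "z = (x, y)" "x \<in> chart_image A i" "y \<noteq> 0" using z by auto
      show ?thesis
        using F_eq[OF i lift_in_SB[OF i xy(2,3)]] Crd_lift_SB[OF i xy(2)]
        by (simp add: fun_rep_def xy(1) chart_inv_SB[OF i xy(2,3)])
    qed
    have F_rep_pos: "fun_rep SB F i z > 0" if "i \<in> Index A" "z \<in> chart_image A i \<times> -{0}" for i z
      using F_rep[OF that] pos[OF that] m by simp
    have F_rep_sq: "Ric_rep A S i z = \<epsilon> * ?m * (fun_rep SB F i z)\<^sup>2" if "i \<in> Index A" "z \<in> chart_image A i \<times> -{0}" for i z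
      using F_rep[OF that] pos[OF that] m \<epsilon>2 by (simp add: mult.assoc[symmetric])
    have F_smooth: "smooth_on (chart_image A i \<times> -{0}) (fun_rep SB F i)" if i: "i \<in> Index A" for i
    proof -
      have o: "open (chart_image A i \<times> -{0::real^'n})" using open_image[OF i] by (intro open_Times) auto
      have "smooth_on (chart_image A i \<times> -{0}) (\<lambda>z. (\<epsilon> / ?m) * Ric_rep A S i z)"
        by (rule smooth_on_bounded_linear[OF o bounded_linear_mult_right smooth_Ric_rep[OF i]])
      then have "smooth_on (chart_image A i \<times> -{0}) (\<lambda>z. ((\<epsilon> / ?m) * Ric_rep A S i z) powr (1/2))"
        by (rule smooth_on_powr[OF o]) (use pos[OF i] m in auto)
      then show ?thesis
        by (subst smooth_on_cong[OF o, of "fun_rep SB F i" "\<lambda>z. ((\<epsilon> / ?m) * Ric_rep A S i z) powr (1/2)"])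
          (use F_rep[OF i] pos[OF i] m in \<open>auto simp: powr_half_sqrt less_imp_le\<close>)
    qed
    have R_hom: "Ric_rep A S i (x, t *\<^sub>R y) = t\<^sup>2 * Ric_rep A S i (x, y)"
      if i: "i \<in> Index A" and xyt: "x \<in> chart_image A i" "y \<noteq> 0" "t > 0" for i x y t
    proof (rule euler_imp_homogeneous[OF smooth_Ric_rep[OF i] _ xyt])
      fix z :: "(real^'n) \<times> (real^'n)" assume z: "z \<in> chart_image A i \<times> -{0}"
      show "dd (Ric_rep A S i) z (0, snd z) = 2 * Ric_rep A S i z"
        unfolding Ric_rep_def Jacobi_rep_def
      proof (rule D1_imp_euler[OF _ z])
        show "smooth_on (chart_image A i \<times> -{0}) (semibasic_trace (jacobi_endo (rep i)))"
          using smooth_Ric_rep[OF i] by (simp add: reps)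
        show "(2 * (real DIM(real^'n) - 1)) *\<^sub>R jacobi_endo (rep i) z w - (2 * semibasic_trace (jacobi_endo (rep i)) z) *\<^sub>R tangent_structure z w
              + dL tangent_structure (semibasic_trace (jacobi_endo (rep i))) z w *\<^sub>R liouville z = 0" for w
        proof -
          have z': "z \<in> chart_image SB i" using z unfolding chart_image_SB[OF i] .
          have dim: "DIM(real^'n) = CARD('n)" by simp
          show ?thesis
            using conds[THEN conjunct2, THEN conjunct1, rule_format, OF i z', of w] unfolding reps dim .
        qed
      qed
    qed
    have F_rep_hom: "fun_rep SB F i (x, t *\<^sub>R y) = t * fun_rep SB F i (x, y)"
      if i: "i \<in> Index A" and xyt: "x \<in> chart_image A i" "y \<noteq> 0" "t > 0" for i x y t
    proof -
      have "fun_rep SB F i (x, t *\<^sub>R y) = sqrt (t\<^sup>2 * (\<epsilon> * Ric_rep A S i (x, y) / ?m))"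
        using F_rep[OF i, of "(x, t *\<^sub>R y)"] R_hom[OF i xyt] xyt by (simp add: mult.left_commute)
      also have "\<dots> = t * sqrt (\<epsilon> * Ric_rep A S i (x, y) / ?m)"
        using xyt by (simp only: real_sqrt_mult real_sqrt_abs abs_of_pos)
      finally show ?thesis using F_rep[OF i, of "(x, y)"] xyt by simp
    qed
    have F_hom: "F (p, \<lambda>i. t *\<^sub>R v i) = t * F (p, v)" if pv: "(p, v) \<in> points TB" and t: "t \<ge> 0" for p v t
    proof (cases "t = 0 \<or> v = (\<lambda>_. 0)")
      case True
      then show ?thesis by (auto simp: F_def)
    next
      case False
      obtain i where i: "i \<in> Index A" and p: "p \<in> Dom A i" and v: "v \<in> tangent_space A p"
        using pv by (auto simp: points_def Index_TB Dom_TB)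
      have tv: "(\<lambda>i. t *\<^sub>R v i) \<in> tangent_space A p" by (rule tangent_space_scale[OF v])
      have v0: "v i \<noteq> 0" using tangent_space_eq_0_iff[OF i p v] False by simp
      then have "(\<lambda>i. t *\<^sub>R v i) \<noteq> (\<lambda>_. 0)" using tangent_space_eq_0_iff[OF i p tv] False by simp
      then have q: "(p, v) \<in> Dom SB i" "(p, \<lambda>i. t *\<^sub>R v i) \<in> Dom SB i"
        using False p v tv by (auto simp: Dom_SB)
      have rep: "F q = fun_rep SB F i (Crd SB i q)" if "q \<in> Dom SB i" for q
        by (simp add: fun_rep_def chart_inv_Crd_SB[OF i that])
      show ?thesis
        unfolding rep[OF q(1)] rep[OF q(2)] Crd_SB
        by (rule F_rep_hom[OF i Crd_in[OF i p] v0]) (use t False in simp)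
    qed
    have F_cont: "continuous_on (chart_image TB i) (fun_rep TB F i)" if i: "i \<in> Index A" for i
      unfolding chart_image_TB[OF i]
    proof (rule continuous_on_homogeneous[OF open_image[OF i]])
      have "fun_rep TB F i z = fun_rep SB F i z" if "z \<in> chart_image A i \<times> -{0}" for z
      proof -
        have xy: "fst z \<in> chart_image A i" "snd z \<noteq> 0" using that by auto
        show ?thesis
          using chart_inv_TB[OF i xy(1), of "snd z"] chart_inv_SB[OF i xy] by (simp add: fun_rep_def)
      qed
      then show "continuous_on (chart_image A i \<times> -{0}) (fun_rep TB F i)"
        using smooth_on_continuous[OF F_smooth[OF i]] continuous_on_cong by metis
      fix x y and t :: real assume x: "x \<in> chart_image A i" and t: "t \<ge> 0"
      let ?p = "chart_inv A i x"
      have p: "?p \<in> Dom A i" by (rule chart_inv_in[OF i x])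
      have "(?p, lift i ?p y) \<in> points TB"
        using lift_in_TB[OF i x] i by (auto simp: points_def Index_TB)
      then show "fun_rep TB F i (x, t *\<^sub>R y) = t * fun_rep TB F i (x, y)"
        using F_hom[of ?p "lift i ?p y" t] t
        by (simp add: fun_rep_def chart_inv_TB[OF i x] lift_scale[OF i p])
    qed
    have F_pos: "F q > 0" if q: "q \<in> points SB" for q
    proof -
      obtain i where i: "i \<in> Index A" "q \<in> Dom SB i" using q by (auto simp: points_def Index_SB)
      show ?thesis using F_eq[OF i] pos[OF i(1) Crd_SB_in[OF i]] m by simp
    qed
    have \<epsilon>0: "\<epsilon> \<noteq> 0" using \<epsilon> by auto
    have chart: "(\<forall>z\<in>chart_image SB i. rank (fundamental_tensor (fun_rep SB F i) z) = CARD('n)) \<and>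
        (\<forall>z\<in>chart_image SB i. \<forall>w. d1 (dL tangent_structure (\<lambda>x. (fun_rep SB F i x)\<^sup>2)) z (rep i z) w
           = - d0 (\<lambda>x. (fun_rep SB F i x)\<^sup>2) z w) \<and>
        (\<forall>z\<in>chart_image SB i. \<forall>w. Jacobi_rep A S i z w = \<epsilon> *\<^sub>R ((fun_rep SB F i z)\<^sup>2 *\<^sub>R tangent_structure z w
                    - (fun_rep SB F i z * dL tangent_structure (fun_rep SB F i) z w) *\<^sub>R liouville z))"
      if i: "i \<in> Index A" for i
    proof -
      have F: "smooth_on (chart_image SB i) (fun_rep SB F i)"
        unfolding chart_image_SB[OF i] by (rule F_smooth[OF i])
      have sq: "Ric_rep A S i z = \<epsilon> * ?m * (fun_rep SB F i z)\<^sup>2" if "z \<in> chart_image SB i" for z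
        using F_rep_sq[OF i] that unfolding chart_image_SB[OF i] .
      note eqs = key[OF i F F_rep_hom[OF i] \<epsilon>0 sq]
      show ?thesis using eqs conds i by blast
    qed
    have "finsler_function A F"
      unfolding finsler_function_def continuous_fun_def smooth_fun_def Index_SB Index_TB
    proof (intro conjI ballI)
      show "smooth_on (chart_image SB i) (fun_rep SB F i)" if "i \<in> Index A" for i
        unfolding chart_image_SB[OF that] by (rule F_smooth[OF that])
      show "case q of (p, v) \<Rightarrow> \<forall>t\<ge>0. F (p, \<lambda>i. t *\<^sub>R v i) = t * F (p, v)" if "q \<in> points TB" for q
        using F_hom that by (cases q) simp
    qed (use F_cont F_pos chart in blast)+
    moreover have "metrizable_by A S F"
      unfolding metrizable_by_def Let_def using chart by blast
    moreover have "constant_flag_curvature A S F \<epsilon>"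
      unfolding constant_flag_curvature_def Let_def using chart by blast
    ultimately show ?L using \<epsilon>0 by blast
  qed
qed

end
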